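(* Let $(\Gamma,\{\cdot,\cdot\}_\Gamma)$ be a phase space with two first class families of constraints $\{\mathcal H_j\}_{j\in J}$ and $\{\mathcal D_j\}_{j\in J}$ in $\mathcal F(\Gamma)$, indexed by the same set $J$, which (locally) completely gauge fix one another in the sense described in the context; in particular the matrix $M_{ij}=\{\mathcal D_i,\mathcal H_j\}_\Gamma$ is invertible on an open set $U$ intersecting the common zero set $S_{J(\mathcal D,\mathcal H)}$ of both families. Let $\mathbb P^{\mathcal D}_{\mathcal H}$ and $\mathbb P^{\mathcal H}_{\mathcal D}$ be the associated complete observable projectors (formal series defined in the context). Then the map $\mathbb P^{\mathcal D}_{\mathcal H}:\mathcal F(\Gamma)\to\mathcal O^w_{J(\mathcal H)}$ has the following properties. 1. It is a (weak, local) Poisson homomorphism, i.e. for all $f,g\in\mathcal F(\Gamma)$, $$\{\mathbb P^{\mathcal D}_{\mathcal H}(f),\mathbb P^{\mathcal D}_{\mathcal H}(g)\}_\Gamma\approx_{S_{J(\mathcal H)}}\mathbb P^{\mathcal D}_{\mathcal H}\big(\{f,g\}_{\mathrm{DB}(\mathcal D,\mathcal H)}\big),$$ $$\mathbb P^{\mathcal D}_{\mathcal H}(f)\,\mathbb P^{\mathcal D}_{\mathcal H}(g)\approx_{S_{J(\mathcal H)}}\mathbb P^{\mathcal D}_{\mathcal H}(fg),$$ $$\mathbb P^{\mathcal D}_{\mathcal H}(f)+\mathbb P^{\mathcal D}_{\mathcal H}(g)=\mathbb P^{\mathcal D}_{\mathcal H}(f+g).$$ Here $\{\cdot,\cdot\}_{\mathrm{DB}(\mathcal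 D,\mathcal H)}$ is the Dirac bracket associated with the two constraint systems; recall that it (weakly) coincides with $\{\cdot,\cdot\}_\Gamma$ on (weak) Dirac observables. 2. It is (weakly, locally) onto, i.e. $\mathbb P^{\mathcal D}_{\mathcal H}(f)\approx_{S_{J(\mathcal H)}}f$ for all $f\in\mathcal O^w_{J(\mathcal H)}$. 3. It defines a (weak, local) Poisson isomorphism $\mathbb P^{\mathcal D}_{\mathcal H}:\mathcal O^w_{J(\mathcal D)}\to\mathcal O^w_{J(\mathcal H)}$ with (weak) inverse $\mathbb P^{\mathcal H}_{\mathcal D}$, i.e. $$\mathbb P^{\mathcal D}_{\mathcal H}\circ\mathbb P^{\mathcal H}_{\mathcal D}\approx_{S_{J(\mathcal H)}}\mathrm{id}_{\mathcal O^w_{J(\mathcal H)}},\qquad \mathbb P^{\mathcal H}_{\mathcal D}\circ\mathbb P^{\mathcal D}_{\mathcal H}\approx_{S_{J(\mathcal D)}}\mathrm{id}_{\mathcal O^w_{J(\mathcal D)}}.$$ 4. It (weakly, locally) annihilates $\mathcal N_{J(\mathcal D,\mathcal H)}:=\{f\in\mathcal F(\Gamma)\ |\ f(x)=0\ \ \forall x\in S_{J(\mathcal D,\mathcal H)}\}$, i.e. $$f\in\mathcal N_{J(\mathcal D,\mathcal H)}\ \Rightarrow\ \mathbb P^{\mathcal D}_{\mathcal H}(f)\approx_{S_{J(\mathcal H)}}0.$$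
   Context: $\Gamma$ is a symplectic (possibly infinite dimensional, Banach) manifold with Poisson bracket $\{\cdot,\cdot\}_\Gamma$, and $\mathcal F(\Gamma)$ is a suitable Poisson algebra of smooth functions on it. The Hamiltonian system is totally constrained and the constraints are irreducible. A family $\{\mathcal C_j\}_{j\in J}\subset\mathcal F(\Gamma)$ is first class if $\{\mathcal C_i,\mathcal C_j\}_\Gamma=f_{ij}{}^{k}\,\mathcal C_k$ (summed over $k$) for some structure functions $f_{ij}{}^{k}\in\mathcal F(\Gamma)$. Write $S_{J(\mathcal H)}$, $S_{J(\mathcal D)}$ and $S_{J(\mathcal D,\mathcal H)}=S_{J(\mathcal D)}\cap S_{J(\mathcal H)}$ for the zero sets of the family $\mathcal H$, of the family $\mathcal D$, and of both. The notation $f\approx_S g$ means that $f$ and $g$ agree on $S$ ("weak" equality). All statements are local, i.e. restricted to the open set $U$ on which $M$ is invertible. Weak Dirac observables: $\mathcal O^w_{J(\mathcal H)}=\{f\in\mathcal F(\Gamma):\{\mathcal H_j,f\}_\Gamma\approx_{S_{J(\mathcal H)}}0\ \ \forall j\in J\}$, and $\mathcal O^w_{J(\mathcal D)}$ is defined in the same way with $\mathcal D$ in place of $\mathcal H$. The Hamiltonian vector field of $h$ is $\chi_h=\{h,\cdot\,\}_\Gamma$, and its flow acts on functions by the formal series $\alpha^*_{\chi_h}(f)=\sum_{n\ge0}\frac1{n!}(\chi_h)^n(f)$. Define $\mathcal H'_j=\sum_{i\in J}(M^{-1})_{ij}\mathcal H_i$ and $\mathcal D'_j=\sum_{i\in J}(M^{-1})_{ji}\mathcal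 D_i$. It is a known fact (Abelianisation Theorem) that the vector fields $\chi_{\mathcal H'_j}$ commute weakly on $S_{J(\mathcal H)}\cap U$, and the $\chi_{\mathcal D'_j}$ commute weakly on $S_{J(\mathcal D)}\cap U$, so that the order of composition below is weakly irrelevant. Complete gauge fixing: $M$ is invertible on $S_{J(\mathcal D,\mathcal H)}$ (locally, on $U$), and, at least locally, for $x\in S_{J(\mathcal H)}$ the equations $\mathcal D_i(\alpha_{\beta^j\chi_{\mathcal H'_j}}(x))=0$ for all $i\in J$ have a unique solution $\beta=\beta^{\mathcal H'}_{\mathcal D}(x)\in\mathbb R^J$; likewise, for $x\in S_{J(\mathcal D)}$, the equations $\mathcal H_j(\alpha_{-\gamma^i\chi_{\mathcal D'_i}}(x))=0$ for all $j\in J$ have a unique solution $\gamma=\gamma^{\mathcal D'}_{\mathcal H}(x)$. The complete observable projectors are given, for $f\in\mathcal F(\Gamma)$, by $$\mathbb P^{\mathcal D}_{\mathcal H}(f)=\sum_{\{k_j\}\in\mathbb N_0^J}\Big(\prod_{j\in J}\frac{(\mathcal D_j)^{k_j}}{k_j!}\Big)\Big(\prod_{j\in J}(\chi_{\mathcal H'_j})^{k_j}\Big)(f)\ \approx_{S_{J(\mathcal H)}}\ \alpha^*_{\beta^j\chi_{\mathcal H'_j}}(f)\big|_{\beta=\beta^{\mathcal H'}_{\mathcal D}},$$ $$\mathbb P^{\mathcal H}_{\mathcal D}(f)=\sum_{\{k_j\}\in\mathbb N_0^J}\Big(\prod_{j\in J}\frac{(-\mathcal H_j)^{k_j}}{k_j!}\Big)\Big(\prod_{j\in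 J}(\chi_{\mathcal D'_j})^{k_j}\Big)(f)\ \approx_{S_{J(\mathcal D)}}\ \alpha^*_{-\gamma^j\chi_{\mathcal D'_j}}(f)\big|_{\gamma=\gamma^{\mathcal D'}_{\mathcal H}},$$ where products of vector fields denote composition as differential operators, and $\beta$, $\gamma$ are treated as constants until the final evaluation. They map $\mathcal F(\Gamma)$ into $\mathcal O^w_{J(\mathcal H)}$ and $\mathcal O^w_{J(\mathcal D)}$ respectively. The series are understood formally: sums, including a sum over infinite $J$, are assumed to make sense, and derivations, products and rearrangements are applied termwise. Dirac bracket: let $\{\mathcal C_a\}$ be the combined (second class) family consisting of all $\mathcal D_j$ and all $\mathcal H_j$, and $\Delta_{ab}=\{\mathcal C_a,\mathcal C_b\}_\Gamma$, which is invertible near $S_{J(\mathcal D,\mathcal H)}$ because $M$ is. Then $\{f,g\}_{\mathrm{DB}(\mathcal D,\mathcal H)}=\{f,g\}_\Gamma-\sum_{a,b}\{f,\mathcal C_a\}_\Gamma(\Delta^{-1})^{ab}\{\mathcal C_b,g\}_\Gamma$. "(Weak) Poisson isomorphism" in item 3 means a map between the two observable algebras that respects sums, products and $\{\cdot,\cdot\}_\Gamma$ weakly (on $S_{J(\mathcal H)}$) and is invertible in the weak sense displayed there. *)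

theory Defs
  imports "HOL-Analysis.Analysis"
begin

section \<open>Symplectic Banach manifolds\<close>

text \<open>
  Smoothness between normed spaces, via directional derivatives so that the codomain type does not
  change. On an open subset of a Banach space this is the usual Frechet smoothness: by
  Banach-Steinhaus, if every \<open>x \<mapsto> Df(x) v\<close> is continuous then \<open>(x, v) \<mapsto> Df(x) v\<close> is jointly
  continuous, and for maps of all orders of differentiability this is the same as being
  infinitely often Frechet differentiable.
\<close>

fun Ck_on :: "nat \<Rightarrow> 'a::real_normed_vector set \<Rightarrow> ('a \<Rightarrow> 'b::real_normed_vector) \<Rightarrow> bool" where
  "Ck_on 0 S f \<longleftrightarrow> continuous_on S f"
| "Ck_on (Suc n) S f \<longleftrightarrow> (\<forall>x\<in>S. f differentiable (at x)) \<and>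
     (\<forall>v. Ck_on n S (\<lambda>x. frechet_derivative f (at x) v))"

definition smooth_on :: "'a::real_normed_vector set \<Rightarrow> ('a \<Rightarrow> 'b::real_normed_vector) \<Rightarrow> bool" where
  "smooth_on S f \<longleftrightarrow> (\<forall>n. Ck_on n S f)"

text \<open>The phase space \<open>\<Gamma>\<close> is the type \<open>'p\<close>; a chart is its domain together with the coordinate map.\<close>

type_synonym ('p, 'e) chart = "'p set \<times> ('p \<Rightarrow> 'e)"

definition in_chart :: "('p, 'e) chart \<Rightarrow> ('p \<Rightarrow> 'b) \<Rightarrow> 'e \<Rightarrow> 'b" where
  "in_chart c f = f \<circ> inv_into (fst c) (snd c)"

definition banach_atlas :: "('p::t2_space, 'e::banach) chart set \<Rightarrow> bool" where
  "banach_atlas A \<longleftrightarrow>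
     (\<Union>c\<in>A. fst c) = UNIV \<and>
     (\<forall>c\<in>A. open (fst c) \<and> open (snd c ` fst c) \<and>
        homeomorphism (fst c) (snd c ` fst c) (snd c) (inv_into (fst c) (snd c))) \<and>
     (\<forall>c\<in>A. \<forall>d\<in>A. smooth_on (snd c ` (fst c \<inter> fst d)) (in_chart c (snd d)))"

definition chart_at :: "('p, 'e) chart set \<Rightarrow> 'p \<Rightarrow> ('p, 'e) chart" where
  "chart_at A x = (SOME c. c \<in> A \<and> x \<in> fst c)"

text \<open>Differential at \<open>x\<close>, acting on the coordinate expression of a tangent vector.\<close>

definition diff_in ::
  "('p, 'e::real_normed_vector) chart \<Rightarrow> ('p \<Rightarrow> 'b::real_normed_vector) \<Rightarrow> 'p \<Rightarrow> 'e \<Rightarrow> 'b" where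
  "diff_in c f x = frechet_derivative (in_chart c f) (at (snd c x))"

text \<open>
  A two-form is given by its coordinate expressions: \<open>om c x v w\<close> is its value at \<open>x\<close> on the tangent
  vectors with coordinates \<open>v\<close> and \<open>w\<close> in the chart \<open>c\<close>. Nondegeneracy is required in the weak
  sense, which covers strong symplectic forms as well.
\<close>

definition symplectic_form ::
  "('p::t2_space, 'e::banach) chart set \<Rightarrow> (('p, 'e) chart \<Rightarrow> 'p \<Rightarrow> 'e \<Rightarrow> 'e \<Rightarrow> real) \<Rightarrow> bool" where
  "symplectic_form A om \<longleftrightarrow>
     (\<forall>c\<in>A. \<forall>x\<in>fst c.
        bounded_bilinear (om c x) \<and>
        (\<forall>v. om c x v v = 0) \<and>
        (\<forall>v. (\<forall>w. om c x v w = 0) \<longrightarrow> v = 0)) \<and>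
     (\<forall>c\<in>A. \<forall>d\<in>A. \<forall>x\<in>fst c \<inter> fst d. \<forall>v w.
        om c x v w = om d x (diff_in c (snd d) x v) (diff_in c (snd d) x w)) \<and>
     (\<forall>c\<in>A. \<forall>v w. smooth_on (snd c ` fst c) (in_chart c (\<lambda>x. om c x v w))) \<and>
     (\<forall>c\<in>A. \<forall>x\<in>fst c. \<forall>u v w.
        diff_in c (\<lambda>y. om c y v w) x u + diff_in c (\<lambda>y. om c y w u) x v
          + diff_in c (\<lambda>y. om c y u v) x w = 0)"

definition is_ham_vec ::
  "(('p, 'e::real_normed_vector) chart \<Rightarrow> 'p \<Rightarrow> 'e \<Rightarrow> 'e \<Rightarrow> real)
     \<Rightarrow> ('p, 'e) chart \<Rightarrow> ('p \<Rightarrow> real) \<Rightarrow> 'p \<Rightarrow> 'e \<Rightarrow> bool" where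
  "is_ham_vec om c h x v \<longleftrightarrow> (\<forall>w. om c x v w = diff_in c h x w)"

definition ham_vec ::
  "(('p, 'e::real_normed_vector) chart \<Rightarrow> 'p \<Rightarrow> 'e \<Rightarrow> 'e \<Rightarrow> real)
     \<Rightarrow> ('p, 'e) chart \<Rightarrow> ('p \<Rightarrow> real) \<Rightarrow> 'p \<Rightarrow> 'e" where
  "ham_vec om c h x = (THE v. is_ham_vec om c h x v)"

text \<open>
  \<open>{h, f} = df(X\<^sub>h)\<close>, so that the Hamiltonian vector field \<open>\<chi>\<^sub>h\<close> as a differential operator is
  the partial application \<open>{h, \<cdot>}\<close>. The value does not depend on the chart.
\<close>

definition poisson_bracket ::
  "('p, 'e::real_normed_vector) chart set \<Rightarrow> (('p, 'e) chart \<Rightarrow> 'p \<Rightarrow> 'e \<Rightarrow> 'e \<Rightarrow> real)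
     \<Rightarrow> ('p \<Rightarrow> real) \<Rightarrow> ('p \<Rightarrow> real) \<Rightarrow> 'p \<Rightarrow> real" where
  "poisson_bracket A om h f x =
     diff_in (chart_at A x) f x (ham_vec om (chart_at A x) h x)"

text \<open>
  Smooth functions on the open set \<open>U\<close> with a smooth Hamiltonian vector field; the existence of
  the latter is a genuine condition when the symplectic form is only weakly nondegenerate.
\<close>

definition hamiltonian_functions ::
  "('p::t2_space, 'e::banach) chart set \<Rightarrow> (('p, 'e) chart \<Rightarrow> 'p \<Rightarrow> 'e \<Rightarrow> 'e \<Rightarrow> real)
     \<Rightarrow> 'p set \<Rightarrow> ('p \<Rightarrow> real) set" where
  "hamiltonian_functions A om U =
     {h. \<forall>c\<in>A. smooth_on (snd c ` (fst c \<inter> U)) (in_chart c h) \<and>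
           (\<forall>x\<in>fst c \<inter> U. \<exists>v. is_ham_vec om c h x v) \<and>
           smooth_on (snd c ` (fst c \<inter> U)) (in_chart c (ham_vec om c h))}"

text \<open>
  A Poisson algebra \<open>F\<close> of smooth functions on \<open>U\<close>. Functions on \<open>U\<close> are represented by total
  functions with irrelevant values outside \<open>U\<close>; hence the second condition.
\<close>

definition poisson_algebra ::
  "('p::t2_space, 'e::banach) chart set \<Rightarrow> (('p, 'e) chart \<Rightarrow> 'p \<Rightarrow> 'e \<Rightarrow> 'e \<Rightarrow> real)
     \<Rightarrow> 'p set \<Rightarrow> ('p \<Rightarrow> real) set \<Rightarrow> bool" where
  "poisson_algebra A om U F \<longleftrightarrow>
     F \<subseteq> hamiltonian_functions A om U \<and>
     (\<forall>f\<in>F. \<forall>g. (\<forall>x\<in>U. g x = f x) \<longrightarrow> g \<in> F) \<and>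
     (\<forall>a. (\<lambda>x. a) \<in> F) \<and>
     (\<forall>f\<in>F. \<forall>g\<in>F. (\<lambda>x. f x + g x) \<in> F \<and> (\<lambda>x. f x * g x) \<in> F \<and> poisson_bracket A om f g \<in> F) \<and>
     (\<forall>f\<in>F. \<forall>g\<in>F. \<forall>h\<in>F. \<forall>x\<in>U.
        poisson_bracket A om f (poisson_bracket A om g h) x
          + poisson_bracket A om g (poisson_bracket A om h f) x
          + poisson_bracket A om h (poisson_bracket A om f g) x = 0)"


section \<open>Formal sums\<close>

definition derivation_on ::
  "('p \<Rightarrow> real) set \<Rightarrow> 'p set \<Rightarrow> (('p \<Rightarrow> real) \<Rightarrow> ('p \<Rightarrow> real)) \<Rightarrow> bool" where
  "derivation_on F U \<delta> \<longleftrightarrow>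
     (\<forall>f\<in>F. \<delta> f \<in> F) \<and>
     (\<forall>f\<in>F. \<forall>g\<in>F. (\<forall>x\<in>U. f x = g x) \<longrightarrow> (\<forall>x\<in>U. \<delta> f x = \<delta> g x)) \<and>
     (\<forall>a. \<forall>f\<in>F. \<forall>x\<in>U. \<delta> (\<lambda>y. a * f y) x = a * \<delta> f x) \<and>
     (\<forall>f\<in>F. \<forall>g\<in>F. \<forall>x\<in>U. \<delta> (\<lambda>y. f y + g y) x = \<delta> f x + \<delta> g x) \<and>
     (\<forall>f\<in>F. \<forall>g\<in>F. \<forall>x\<in>U. \<delta> (\<lambda>y. f y * g y) x = \<delta> f x * g x + f x * \<delta> g x)"

text \<open>
  The meaning given to infinite sums in \<open>F\<close>, over multi-indices or over an infinite constraint
  index set: the sum exists pointwise and unconditionally on \<open>U\<close>, lies in \<open>F\<close>, and derivations may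
  be applied to it term by term, arbitrarily often. Unconditional convergence in the reals is
  absolute, so products and rearrangements are termwise too. A finite sum of members of \<open>F\<close> always
  qualifies, so for finitely many constraints this says nothing about sums over the constraints.
\<close>

definition termwise_sum ::
  "('p \<Rightarrow> real) set \<Rightarrow> 'p set \<Rightarrow> 'i set \<Rightarrow> ('i \<Rightarrow> 'p \<Rightarrow> real) \<Rightarrow> ('p \<Rightarrow> real) \<Rightarrow> bool" where
  "termwise_sum F U I g s \<longleftrightarrow>
     s \<in> F \<and> (\<forall>i\<in>I. g i \<in> F) \<and>
     (\<forall>\<delta>s. (\<forall>\<delta>\<in>set \<delta>s. derivation_on F U \<delta>) \<longrightarrow>
        (\<forall>x\<in>U. ((\<lambda>i. foldr (\<lambda>\<delta>. \<delta>) \<delta>s (g i) x) has_sum foldr (\<lambda>\<delta>. \<delta>) \<delta>s s x) I))"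


section \<open>Constraints\<close>

text \<open>
  From here on \<open>pb\<close> is the Poisson bracket, and a family of constraints is indexed by the type
  \<open>'j\<close>, which plays the role of the index set \<open>J\<close>.
\<close>

definition zero_set :: "('j \<Rightarrow> 'p \<Rightarrow> real) \<Rightarrow> 'p set" where
  "zero_set C = {x. \<forall>j. C j x = 0}"

definition weakly_eq :: "'p set \<Rightarrow> ('p \<Rightarrow> real) \<Rightarrow> ('p \<Rightarrow> real) \<Rightarrow> bool" where
  "weakly_eq S f g \<longleftrightarrow> (\<forall>x\<in>S. f x = g x)"

definition first_class ::
  "(('p \<Rightarrow> real) \<Rightarrow> ('p \<Rightarrow> real) \<Rightarrow> 'p \<Rightarrow> real) \<Rightarrow> ('p \<Rightarrow> real) set \<Rightarrow> 'p set
     \<Rightarrow> ('j \<Rightarrow> 'p \<Rightarrow> real) \<Rightarrow> bool" where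
  "first_class pb F U C \<longleftrightarrow>
     (\<forall>j. C j \<in> F) \<and>
     (\<exists>s. \<forall>i j. (\<forall>k. s i j k \<in> F) \<and>
        termwise_sum F U UNIV (\<lambda>k x. s i j k x * C k x) (pb (C i) (C j)))"

definition irreducible_constraints ::
  "('p, 'e::real_normed_vector) chart set \<Rightarrow> 'p set \<Rightarrow> ('j \<Rightarrow> 'p \<Rightarrow> real) \<Rightarrow> bool" where
  "irreducible_constraints A U C \<longleftrightarrow>
     (\<forall>x\<in>zero_set C \<inter> U. \<forall>a. finite {j. a j \<noteq> 0} \<longrightarrow>
        (\<forall>v. (\<Sum>j | a j \<noteq> 0. a j * diff_in (chart_at A x) (C j) x v) = 0) \<longrightarrow> (\<forall>j. a j = 0))"

definition weak_observables ::
  "(('p \<Rightarrow> real) \<Rightarrow> ('p \<Rightarrow> real) \<Rightarrow> 'p \<Rightarrow> real) \<Rightarrow> ('p \<Rightarrow> real) set \<Rightarrow> 'p set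
     \<Rightarrow> ('j \<Rightarrow> 'p \<Rightarrow> real) \<Rightarrow> ('p \<Rightarrow> real) set" where
  "weak_observables pb F U C =
     {f\<in>F. \<forall>j. weakly_eq (zero_set C \<inter> U) (pb (C j) f) (\<lambda>x. 0)}"

definition matrix_inverse ::
  "('p \<Rightarrow> real) set \<Rightarrow> 'p set \<Rightarrow> ('i \<Rightarrow> 'i \<Rightarrow> 'p \<Rightarrow> real) \<Rightarrow> ('i \<Rightarrow> 'i \<Rightarrow> 'p \<Rightarrow> real) \<Rightarrow> bool" where
  "matrix_inverse F U M N \<longleftrightarrow>
     (\<forall>i j. N i j \<in> F) \<and>
     (\<forall>i k. termwise_sum F U UNIV (\<lambda>j x. M i j x * N j k x) (\<lambda>x. if i = k then 1 else 0)) \<and>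
     (\<forall>i k. termwise_sum F U UNIV (\<lambda>j x. N i j x * M j k x) (\<lambda>x. if i = k then 1 else 0))"

definition H_prime :: "('j \<Rightarrow> 'j \<Rightarrow> 'p \<Rightarrow> real) \<Rightarrow> ('j \<Rightarrow> 'p \<Rightarrow> real) \<Rightarrow> 'j \<Rightarrow> 'p \<Rightarrow> real" where
  "H_prime N H j = (\<lambda>x. \<Sum>\<^sub>\<infinity>i. N i j x * H i x)"

definition D_prime :: "('j \<Rightarrow> 'j \<Rightarrow> 'p \<Rightarrow> real) \<Rightarrow> ('j \<Rightarrow> 'p \<Rightarrow> real) \<Rightarrow> 'j \<Rightarrow> 'p \<Rightarrow> real" where
  "D_prime N D j = (\<lambda>x. \<Sum>\<^sub>\<infinity>i. N j i x * D i x)"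


section \<open>Dirac bracket\<close>

definition combined :: "('j \<Rightarrow> 'p \<Rightarrow> real) \<Rightarrow> ('j \<Rightarrow> 'p \<Rightarrow> real) \<Rightarrow> 'j + 'j \<Rightarrow> 'p \<Rightarrow> real" where
  "combined D H = case_sum D H"

text \<open>\<open>E\<close> is the inverse of the matrix of brackets of the family \<open>C\<close>.\<close>

definition dirac_term ::
  "(('p \<Rightarrow> real) \<Rightarrow> ('p \<Rightarrow> real) \<Rightarrow> 'p \<Rightarrow> real) \<Rightarrow> ('i \<Rightarrow> 'p \<Rightarrow> real) \<Rightarrow> ('i \<Rightarrow> 'i \<Rightarrow> 'p \<Rightarrow> real)
     \<Rightarrow> ('p \<Rightarrow> real) \<Rightarrow> ('p \<Rightarrow> real) \<Rightarrow> 'i \<times> 'i \<Rightarrow> 'p \<Rightarrow> real" where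
  "dirac_term pb C E f g = (\<lambda>(a, b) x. pb f (C a) x * E a b x * pb (C b) g x)"

definition dirac_bracket ::
  "(('p \<Rightarrow> real) \<Rightarrow> ('p \<Rightarrow> real) \<Rightarrow> 'p \<Rightarrow> real) \<Rightarrow> ('i \<Rightarrow> 'p \<Rightarrow> real) \<Rightarrow> ('i \<Rightarrow> 'i \<Rightarrow> 'p \<Rightarrow> real)
     \<Rightarrow> ('p \<Rightarrow> real) \<Rightarrow> ('p \<Rightarrow> real) \<Rightarrow> 'p \<Rightarrow> real" where
  "dirac_bracket pb C E f g = (\<lambda>x. pb f g x - (\<Sum>\<^sub>\<infinity>ab. dirac_term pb C E f g ab x))"


section \<open>Complete observable projectors\<close>

definition multi_indices :: "('j \<Rightarrow> nat) set" where
  "multi_indices = {k. finite {j. k j \<noteq> 0}}"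

text \<open>
  The composition of the \<open>(\<chi>\<^bsub>G j\<^esub>)^(k j)\<close> is taken in the order of the index type, which is an
  arbitrary linear order; the order is weakly irrelevant.
\<close>

definition chi_multi ::
  "(('p \<Rightarrow> real) \<Rightarrow> ('p \<Rightarrow> real) \<Rightarrow> 'p \<Rightarrow> real) \<Rightarrow> ('j::linorder \<Rightarrow> 'p \<Rightarrow> real)
     \<Rightarrow> ('j \<Rightarrow> nat) \<Rightarrow> ('p \<Rightarrow> real) \<Rightarrow> 'p \<Rightarrow> real" where
  "chi_multi pb G k f =
     foldr (\<lambda>j. pb (G j) ^^ k j) (sorted_list_of_set {j. k j \<noteq> 0}) f"

definition projector_term ::
  "(('p \<Rightarrow> real) \<Rightarrow> ('p \<Rightarrow> real) \<Rightarrow> 'p \<Rightarrow> real) \<Rightarrow> ('j::linorder \<Rightarrow> 'p \<Rightarrow> real)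
     \<Rightarrow> ('j \<Rightarrow> 'p \<Rightarrow> real) \<Rightarrow> ('p \<Rightarrow> real) \<Rightarrow> ('j \<Rightarrow> nat) \<Rightarrow> 'p \<Rightarrow> real" where
  "projector_term pb B G f k =
     (\<lambda>x. (\<Prod>j | k j \<noteq> 0. B j x ^ k j / fact (k j)) * chi_multi pb G k f x)"

definition projector ::
  "(('p \<Rightarrow> real) \<Rightarrow> ('p \<Rightarrow> real) \<Rightarrow> 'p \<Rightarrow> real) \<Rightarrow> ('j::linorder \<Rightarrow> 'p \<Rightarrow> real)
     \<Rightarrow> ('j \<Rightarrow> 'p \<Rightarrow> real) \<Rightarrow> ('p \<Rightarrow> real) \<Rightarrow> 'p \<Rightarrow> real" where
  "projector pb B G f = (\<lambda>x. \<Sum>\<^sub>\<infinity>k\<in>multi_indices. projector_term pb B G f k x)"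


section \<open>Flows and complete gauge fixing\<close>

definition integral_curve ::
  "('p::t2_space, 'e::banach) chart set \<Rightarrow> (('p, 'e) chart \<Rightarrow> 'p \<Rightarrow> 'e \<Rightarrow> 'e \<Rightarrow> real)
     \<Rightarrow> 'p set \<Rightarrow> ('p \<Rightarrow> real) \<Rightarrow> (real \<Rightarrow> 'p) \<Rightarrow> bool" where
  "integral_curve A om U h \<gamma> \<longleftrightarrow>
     continuous_on {0..1} \<gamma> \<and> \<gamma> ` {0..1} \<subseteq> U \<and>
     (\<forall>t\<in>{0..1}. \<forall>c\<in>A. \<gamma> t \<in> fst c \<longrightarrow>
        ((\<lambda>s. snd c (\<gamma> s)) has_vector_derivative ham_vec om c h (\<gamma> t)) (at t within {0..1}))"

text \<open>
  \<open>y\<close> is the image of \<open>x\<close> under the time-one flow of \<open>\<chi>\<^sub>h\<close> inside \<open>U\<close>, the flow acting on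
  functions by the exponential series of \<open>\<chi>\<^sub>h\<close>.
\<close>

definition flows_to ::
  "('p::t2_space, 'e::banach) chart set \<Rightarrow> (('p, 'e) chart \<Rightarrow> 'p \<Rightarrow> 'e \<Rightarrow> 'e \<Rightarrow> real)
     \<Rightarrow> 'p set \<Rightarrow> ('p \<Rightarrow> real) set \<Rightarrow> ('p \<Rightarrow> real) \<Rightarrow> 'p \<Rightarrow> 'p \<Rightarrow> bool" where
  "flows_to A om U F h x y \<longleftrightarrow>
     (\<exists>\<gamma>. integral_curve A om U h \<gamma> \<and> \<gamma> 0 = x \<and> \<gamma> 1 = y \<and>
        (\<forall>f\<in>F. \<forall>t\<in>{0..1}.
           (\<lambda>n. t ^ n / fact n * (poisson_bracket A om h ^^ n) f x) sums f (\<gamma> t)))"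

text \<open>
  From each point of the constraint surface of \<open>C\<close> in \<open>U\<close>, exactly one \<open>\<beta>\<close> is such that the flow
  of \<open>\<Sum>\<^sub>j \<beta>\<^sub>j \<chi>\<^bsub>G j\<^esub>\<close> (with constant \<open>\<beta>\<close>, hence of the Hamiltonian \<open>\<Sum>\<^sub>j \<beta>\<^sub>j G\<^sub>j\<close>) ends on the
  zero set of \<open>B\<close>.
\<close>

definition gauge_fixes ::
  "('p::t2_space, 'e::banach) chart set \<Rightarrow> (('p, 'e) chart \<Rightarrow> 'p \<Rightarrow> 'e \<Rightarrow> 'e \<Rightarrow> real)
     \<Rightarrow> 'p set \<Rightarrow> ('p \<Rightarrow> real) set
     \<Rightarrow> ('j \<Rightarrow> 'p \<Rightarrow> real) \<Rightarrow> ('j \<Rightarrow> 'p \<Rightarrow> real) \<Rightarrow> ('j \<Rightarrow> 'p \<Rightarrow> real) \<Rightarrow> bool" where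
  "gauge_fixes A om U F B C G \<longleftrightarrow>
     (\<forall>x\<in>zero_set C \<inter> U. \<exists>!\<beta>. \<exists>h y.
        termwise_sum F U UNIV (\<lambda>j z. \<beta> j * G j z) h \<and>
        flows_to A om U F h x y \<and> (\<forall>i. B i y = 0))"

end

theory Submission
  imports Defs "HOL-Library.Multiset"
begin

text \<open>
  Functions in the closed ideal \<open>\<I>\<close> generated by the \<open>H\<^sub>j\<close> (closed under termwise sums) vanish on
  the constraint surface, and every derivation that sends the \<open>H\<^sub>j\<close> into \<open>\<I>\<close> preserves \<open>\<I>\<close>. Modulo
  \<open>\<I>\<close> the \<open>{H'\<^sub>j, \<cdot>}\<close> commute and \<open>{H'\<^sub>j, D\<^sub>i} = -\<delta>\<^sub>i\<^sub>j\<close>, so \<open>{H'\<^sub>j, P f}\<close> telescopes into \<open>\<I>\<close> and \<open>P f\<close>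
  is an observable. An observable is constant along the gauge-fixing flow, hence determined by its
  values where both families vanish. There \<open>P f = f\<close>, and all identities are compared there.

  For infinitely many constraints products of infinite matrices need not be associative, so \<open>M\<close> and
  \<open>\<Delta>\<close> cannot simply be inverted. The way around is that the Dirac bracket is itself a derivation
  annihilating all constraints, hence may be applied term by term.
\<close>

section \<open>Derivations and termwise sums\<close>

text \<open>Membership in \<open>\<I>\<close>, not mere vanishing on the constraint surface, is what
  the computations carry along: the zero set need not be a submanifold, so a derivation that sends
  the constraints into \<open>\<I>\<close> is not known to preserve the functions vanishing there.
  The opposite difficulty arises with observables, whose brackets with the constraints are known
  only as values on the surface; those steps use the product rule at a single point.

  Commuting fields require more than {\<open>H' i\<close>, \<open>H' j\<close>} in
  \<open>\<I>\<close>: the commutator is the field of this function, and its action on an arbitrary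
  \<open>f\<close> has to land in \<open>\<I>\<close> again. The Dirac bracket closes the gap, since
  it leaves only brackets with the \<open>D k\<close> to examine, and the Jacobi identity settles
  those.

  The bracket identity has the same source. On the surface the Dirac bracket of two observables is
  their Poisson bracket, and it annihilates every \<open>D i\<close>; at common zeros each
  \<open>P\<close> may therefore be dropped, because all terms of its series except the first carry
  factors \<open>D i\<close>.\<close>

lemma has_sum_transform:
  assumes "(f has_sum s) I" "\<And>i. i \<in> I \<Longrightarrow> g i = f i" "t = s"
  shows "(g has_sum t) I"
  using assms(1) unfolding assms(3) by (simp only: has_sum_cong[OF assms(2)])

lemma has_sum_single_index:
  assumes "\<And>i. i \<in> I \<Longrightarrow> i \<noteq> j \<Longrightarrow> f i = 0" "j \<in> I"
  shows "(f has_sum f j) I"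
proof -
  have "(f has_sum f j) {j} \<longleftrightarrow> (f has_sum f j) I"
    by (rule has_sum_cong_neutral) (use assms in auto)
  then show ?thesis by (simp add: has_sum_finiteI)
qed

lemma has_sum_pair_left:
  fixes f :: "'a \<times> 'b \<Rightarrow> real"
  assumes "(f has_sum S) UNIV" "\<And>a. ((\<lambda>b. f (a, b)) has_sum g a) UNIV"
  shows "(g has_sum S) UNIV"
  by (rule has_sum_SigmaD[where A = UNIV and B = "\<lambda>_. UNIV" and f = f]) (use assms in simp_all)

lemma has_sum_pair_right:
  fixes f :: "'a \<times> 'b \<Rightarrow> real"
  assumes "(f has_sum S) UNIV" "\<And>b. ((\<lambda>a. f (a, b)) has_sum g b) UNIV"
  shows "(g has_sum S) UNIV"
proof (rule has_sum_pair_left[of "f \<circ> prod.swap"])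
  have "((\<lambda>x. f (prod.swap x)) has_sum S) UNIV \<longleftrightarrow> (f has_sum S) UNIV"
    by (rule has_sum_reindex_bij_betw) (simp add: bij_betw_def surj_swap)
  then show "(f \<circ> prod.swap has_sum S) UNIV"
    using assms(1) by (simp add: o_def)
qed (use assms(2) in simp)

text \<open>Convergence at \<open>t = 1\<close> makes the sum continuous at 0, where its right limit
  is the constant term. Removing that term and dividing by \<open>t\<close> leaves a series of the
  same kind. Times are one-sided because flows are given on \<open>{0..1}\<close>.\<close>

lemma power_series_zero_coeff:
  fixes a :: "nat \<Rightarrow> real"
  assumes "\<And>t. 0 < t \<Longrightarrow> t \<le> 1 \<Longrightarrow> (\<lambda>n. t ^ n * a n) sums 0"
  shows "a n = 0"
proof -
  have constant_term: "a 0 = 0" if sums: "\<And>t. 0 < t \<Longrightarrow> t \<le> 1 \<Longrightarrow> (\<lambda>n. t ^ n * a n) sums 0"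
    for a :: "nat \<Rightarrow> real"
  proof -
    define F where "F x = (\<Sum>n. a n * x ^ n)" for x
    have "summable (\<lambda>n. a n * 1 ^ n)"
      using sums[of 1] by (simp add: sums_iff)
    then have "(\<lambda>n. a n * x ^ n) sums F x" if "norm x < 1" for x
      unfolding F_def using powser_inside[of a 1 x] that by (simp add: summable_sums)
    then have "(F \<longlongrightarrow> a 0) (at 0)"
      by (intro powser_limit_0[of 1]) auto
    then have lim: "(F \<longlongrightarrow> a 0) (at_right 0)"
      by (rule tendsto_mono[rotated]) (simp add: at_le)
    have "F x = 0" if "0 < x" "x < 1" for x
      using sums[of x] that unfolding F_def by (simp add: sums_iff mult.commute)
    then have "\<forall>\<^sub>F x in at_right 0. F x = 0"
      unfolding eventually_at_right_field by (intro exI[of _ 1]) auto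
    then have "(F \<longlongrightarrow> 0) (at_right 0)"
      by (rule tendsto_eventually)
    with lim show ?thesis
      using tendsto_unique[of "at_right (0::real)"] by auto
  qed
  show ?thesis
    using assms
  proof (induction n arbitrary: a)
    case (0 a)
    then show ?case by (rule constant_term)
  next
    case (Suc n a)
    have "(\<lambda>n. t ^ n * a (Suc n)) sums 0" if t: "0 < t" "t \<le> 1" for t
    proof -
      have "(\<lambda>n. t ^ Suc n * a (Suc n)) sums 0"
        using Suc.prems[OF t] constant_term[OF Suc.prems]
          sums_Suc_iff[of "\<lambda>n. t ^ n * a n" 0] by simp
      then have "(\<lambda>n. inverse t * (t ^ Suc n * a (Suc n))) sums (inverse t * 0)"
        by (rule sums_mult)
      then show ?thesis
        using t by (simp add: field_simps)
    qed
    then show ?case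
      by (rule Suc.IH[of "\<lambda>n. a (Suc n)"])
  qed
qed

locale function_algebra =
  fixes F :: "('p \<Rightarrow> real) set" and U :: "'p set"
  assumes mem_cong: "f \<in> F \<Longrightarrow> (\<And>x. x \<in> U \<Longrightarrow> g x = f x) \<Longrightarrow> g \<in> F"
    and const_mem [simp]: "(\<lambda>x. a) \<in> F"
    and add_mem: "f \<in> F \<Longrightarrow> g \<in> F \<Longrightarrow> (\<lambda>x. f x + g x) \<in> F"
    and mult_mem: "f \<in> F \<Longrightarrow> g \<in> F \<Longrightarrow> (\<lambda>x. f x * g x) \<in> F"
begin

abbreviation der where "der \<equiv> derivation_on F U"
abbreviation tsum where "tsum \<equiv> termwise_sum F U"
abbreviation iter :: "(('p \<Rightarrow> real) \<Rightarrow> 'p \<Rightarrow> real) list \<Rightarrow> ('p \<Rightarrow> real) \<Rightarrow> 'p \<Rightarrow> real"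
  where "iter \<equiv> foldr (\<lambda>\<delta>. \<delta>)"

lemma scale_mem: "f \<in> F \<Longrightarrow> (\<lambda>x. a * f x) \<in> F"
  by (rule mult_mem) simp_all

lemma minus_mem: "f \<in> F \<Longrightarrow> (\<lambda>x. - f x) \<in> F"
  using scale_mem[of f "-1"] by simp

lemma diff_mem: "f \<in> F \<Longrightarrow> g \<in> F \<Longrightarrow> (\<lambda>x. f x - g x) \<in> F"
  using add_mem[of f "\<lambda>x. - g x"] minus_mem[of g] by simp

lemma power_mem: "f \<in> F \<Longrightarrow> (\<lambda>x. f x ^ n) \<in> F"
  by (induction n) (auto intro: mult_mem)

lemma divide_mem: "f \<in> F \<Longrightarrow> (\<lambda>x. f x / a) \<in> F"
  using scale_mem[of f "inverse a"] by (simp add: field_simps)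

lemma prod_mem: "(\<And>i. i \<in> I \<Longrightarrow> f i \<in> F) \<Longrightarrow> (\<lambda>x. \<Prod>i\<in>I. f i x) \<in> F"
  by (induction I rule: infinite_finite_induct) (auto intro: mult_mem)

lemma der_mem: "der \<delta> \<Longrightarrow> f \<in> F \<Longrightarrow> \<delta> f \<in> F"
  unfolding derivation_on_def by blast

lemma der_cong:
  "der \<delta> \<Longrightarrow> f \<in> F \<Longrightarrow> (\<And>y. y \<in> U \<Longrightarrow> g y = f y) \<Longrightarrow> x \<in> U \<Longrightarrow> \<delta> g x = \<delta> f x"
  using mem_cong[of f g] unfolding derivation_on_def by blast

lemma der_scale: "der \<delta> \<Longrightarrow> f \<in> F \<Longrightarrow> x \<in> U \<Longrightarrow> \<delta> (\<lambda>y. a * f y) x = a * \<delta> f x"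
  unfolding derivation_on_def by blast

lemma der_add:
  "der \<delta> \<Longrightarrow> f \<in> F \<Longrightarrow> g \<in> F \<Longrightarrow> x \<in> U \<Longrightarrow> \<delta> (\<lambda>y. f y + g y) x = \<delta> f x + \<delta> g x"
  unfolding derivation_on_def by blast

lemma der_mult:
  "der \<delta> \<Longrightarrow> f \<in> F \<Longrightarrow> g \<in> F \<Longrightarrow> x \<in> U \<Longrightarrow> \<delta> (\<lambda>y. f y * g y) x = \<delta> f x * g x + f x * \<delta> g x"
  unfolding derivation_on_def by blast

lemma der_minus: "der \<delta> \<Longrightarrow> f \<in> F \<Longrightarrow> x \<in> U \<Longrightarrow> \<delta> (\<lambda>y. - f y) x = - \<delta> f x"
  using der_scale[of \<delta> f x "-1"] by simp

lemma der_diff: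
  assumes "der \<delta>" "f \<in> F" "g \<in> F" "x \<in> U"
  shows "\<delta> (\<lambda>y. f y - g y) x = \<delta> f x - \<delta> g x"
  using der_add[OF assms(1,2) minus_mem[OF assms(3)] assms(4)] der_minus[OF assms(1,3,4)] by simp

lemma der_const:
  assumes "der \<delta>" "x \<in> U"
  shows "\<delta> (\<lambda>y. a) x = 0"
proof -
  have "\<delta> (\<lambda>y. 1) x = 0"
    using der_mult[OF assms(1) const_mem[of 1] const_mem[of 1] assms(2)] by simp
  then show ?thesis
    using der_scale[OF assms(1) const_mem[of 1] assms(2), of a] by simp
qed

lemma derI:
  assumes "\<And>f. f \<in> F \<Longrightarrow> \<delta> f \<in> F"
    "\<And>f g x. f \<in> F \<Longrightarrow> g \<in> F \<Longrightarrow> (\<And>y. y \<in> U \<Longrightarrow> f y = g y) \<Longrightarrow> x \<in> U \<Longrightarrow> \<delta> f x = \<delta> g x"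
    "\<And>a f x. f \<in> F \<Longrightarrow> x \<in> U \<Longrightarrow> \<delta> (\<lambda>y. a * f y) x = a * \<delta> f x"
    "\<And>f g x. f \<in> F \<Longrightarrow> g \<in> F \<Longrightarrow> x \<in> U \<Longrightarrow> \<delta> (\<lambda>y. f y + g y) x = \<delta> f x + \<delta> g x"
    "\<And>f g x. f \<in> F \<Longrightarrow> g \<in> F \<Longrightarrow> x \<in> U \<Longrightarrow> \<delta> (\<lambda>y. f y * g y) x = \<delta> f x * g x + f x * \<delta> g x"
  shows "der \<delta>"
  unfolding derivation_on_def
  by (intro conjI ballI allI impI; (rule assms; blast)?; rule assms; assumption)

lemma der_scaled:
  assumes "a \<in> F" "der \<delta>"
  shows "der (\<lambda>g x. a x * \<delta> g x)"
proof (rule derI, goal_cases)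
  case (2 f g x)
  then show ?case using der_cong[OF assms(2), of g f x] by simp
qed (use assms in \<open>simp_all add: der_mem mult_mem der_scale der_add der_mult algebra_simps\<close>)

lemma der_subtract:
  assumes "der \<delta>" "der \<epsilon>"
  shows "der (\<lambda>g x. \<delta> g x - \<epsilon> g x)"
proof (rule derI, goal_cases)
  case (2 f g x)
  then show ?case using der_cong[OF assms(1), of g f x] der_cong[OF assms(2), of g f x] by simp
qed (use assms in \<open>simp_all add: der_mem diff_mem der_scale der_add der_mult algebra_simps\<close>)

lemma iter_mem: "set \<delta>s \<subseteq> Collect der \<Longrightarrow> f \<in> F \<Longrightarrow> iter \<delta>s f \<in> F"
  by (induction \<delta>s) (auto intro: der_mem)

lemma iter_cong:
  "set \<delta>s \<subseteq> Collect der \<Longrightarrow> f \<in> F \<Longrightarrow> (\<And>y. y \<in> U \<Longrightarrow> g y = f y) \<Longrightarrow> x \<in> U \<Longrightarrow>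
    iter \<delta>s g x = iter \<delta>s f x"
proof (induction \<delta>s arbitrary: x)
  case (Cons \<delta> \<delta>s)
  then have \<delta>: "der \<delta>" and \<delta>s: "set \<delta>s \<subseteq> Collect der"
    by auto
  have "\<delta> (iter \<delta>s g) x = \<delta> (iter \<delta>s f) x"
    using iter_mem[OF \<delta>s Cons.prems(2)] Cons.IH[OF \<delta>s Cons.prems(2,3)] Cons.prems(4)
    by (rule der_cong[OF \<delta>])
  then show ?case by simp
qed simp

lemma iter_add:
  "set \<delta>s \<subseteq> Collect der \<Longrightarrow> f \<in> F \<Longrightarrow> g \<in> F \<Longrightarrow> x \<in> U \<Longrightarrow>
    iter \<delta>s (\<lambda>y. f y + g y) x = iter \<delta>s f x + iter \<delta>s g x"
proof (induction \<delta>s arbitrary: x)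
  case (Cons \<delta> \<delta>s)
  then have \<delta>: "der \<delta>" and \<delta>s: "set \<delta>s \<subseteq> Collect der"
    by auto
  note mem = iter_mem[OF \<delta>s Cons.prems(2)] iter_mem[OF \<delta>s Cons.prems(3)]
  have "\<delta> (iter \<delta>s (\<lambda>y. f y + g y)) x = \<delta> (\<lambda>y. iter \<delta>s f y + iter \<delta>s g y) x"
    using add_mem[OF mem] Cons.IH[OF \<delta>s Cons.prems(2,3)] Cons.prems(4)
    by (rule der_cong[OF \<delta>])
  then show ?case
    using der_add[OF \<delta> mem Cons.prems(4)] by simp
qed simp

lemma tsum_mem: "tsum I g s \<Longrightarrow> s \<in> F"
  and tsum_term_mem: "tsum I g s \<Longrightarrow> i \<in> I \<Longrightarrow> g i \<in> F"
  by (auto simp: termwise_sum_def)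

lemma tsum_iter:
  "tsum I g s \<Longrightarrow> set \<delta>s \<subseteq> Collect der \<Longrightarrow> x \<in> U \<Longrightarrow>
    ((\<lambda>i. iter \<delta>s (g i) x) has_sum iter \<delta>s s x) I"
  unfolding termwise_sum_def by blast

lemma tsum_has_sum: "tsum I g s \<Longrightarrow> x \<in> U \<Longrightarrow> ((\<lambda>i. g i x) has_sum s x) I"
  using tsum_iter[of I g s "[]"] by simp

lemma tsumI:
  "s \<in> F \<Longrightarrow> (\<And>i. i \<in> I \<Longrightarrow> g i \<in> F) \<Longrightarrow>
    (\<And>\<delta>s x. set \<delta>s \<subseteq> Collect der \<Longrightarrow> x \<in> U \<Longrightarrow>
      ((\<lambda>i. iter \<delta>s (g i) x) has_sum iter \<delta>s s x) I) \<Longrightarrow> tsum I g s"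
  unfolding termwise_sum_def by (simp add: subset_iff)

lemma tsum_der:
  assumes "tsum I g s" "der \<delta>"
  shows "tsum I (\<lambda>i. \<delta> (g i)) (\<delta> s)"
proof (rule tsumI)
  fix \<delta>s :: "(('p \<Rightarrow> real) \<Rightarrow> 'p \<Rightarrow> real) list" and x
  assume "set \<delta>s \<subseteq> Collect der" "x \<in> U"
  then show "((\<lambda>i. iter \<delta>s (\<delta> (g i)) x) has_sum iter \<delta>s (\<delta> s) x) I"
    using tsum_iter[OF assms(1), of "\<delta>s @ [\<delta>]" x] assms(2) by simp
qed (use assms in \<open>simp_all add: der_mem tsum_mem tsum_term_mem\<close>)

lemma tsum_cong:
  assumes "tsum I g s" "\<And>i x. i \<in> I \<Longrightarrow> x \<in> U \<Longrightarrow> g' i x = g i x" "\<And>x. x \<in> U \<Longrightarrow> s' x = s x"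
  shows "tsum I g' s'"
proof (rule tsumI)
  fix \<delta>s :: "(('p \<Rightarrow> real) \<Rightarrow> 'p \<Rightarrow> real) list" and x
  assume *: "set \<delta>s \<subseteq> Collect der" "x \<in> U"
  show "((\<lambda>i. iter \<delta>s (g' i) x) has_sum iter \<delta>s s' x) I"
  proof (rule has_sum_transform[OF tsum_iter[OF assms(1) *]])
    show "iter \<delta>s s' x = iter \<delta>s s x"
      using assms(3) *(2) by (rule iter_cong[OF *(1) tsum_mem[OF assms(1)]])
    show "iter \<delta>s (g' i) x = iter \<delta>s (g i) x" if "i \<in> I" for i
      using assms(2)[OF that] *(2) by (rule iter_cong[OF *(1) tsum_term_mem[OF assms(1) that]])
  qed
next
  show "s' \<in> F"
    by (rule mem_cong[OF tsum_mem[OF assms(1)] assms(3)])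
  show "g' i \<in> F" if "i \<in> I" for i
    by (rule mem_cong[OF tsum_term_mem[OF assms(1) that] assms(2)[OF that]])
qed

lemma tsum_add:
  assumes "tsum I g s" "tsum I h t"
  shows "tsum I (\<lambda>i x. g i x + h i x) (\<lambda>x. s x + t x)"
proof (rule tsumI)
  fix \<delta>s :: "(('p \<Rightarrow> real) \<Rightarrow> 'p \<Rightarrow> real) list" and x
  assume *: "set \<delta>s \<subseteq> Collect der" "x \<in> U"
  show "((\<lambda>i. iter \<delta>s (\<lambda>x. g i x + h i x) x) has_sum iter \<delta>s (\<lambda>x. s x + t x) x) I"
    using * tsum_mem[OF assms(1)] tsum_mem[OF assms(2)] tsum_term_mem[OF assms(1)]
      tsum_term_mem[OF assms(2)]
    by (intro has_sum_transform[OF has_sum_add[OF tsum_iter[OF assms(1) *] tsum_iter[OF assms(2) *]]]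
        iter_add)
qed (use assms in \<open>simp_all add: add_mem tsum_mem tsum_term_mem\<close>)

text \<open>The induction removes the innermost derivation, which is the last of the list. The
  product rule turns one product into two of the same shape, with either factor differentiated, so
  \<open>a\<close>, \<open>g\<close> and \<open>s\<close> all have to vary.\<close>

lemma tsum_mult:
  assumes "a \<in> F" "tsum I g s"
  shows "tsum I (\<lambda>i x. a x * g i x) (\<lambda>x. a x * s x)"
proof (rule tsumI)
  fix \<delta>s :: "(('p \<Rightarrow> real) \<Rightarrow> 'p \<Rightarrow> real) list" and x
  assume "set \<delta>s \<subseteq> Collect der" "x \<in> U"
  then show "((\<lambda>i. iter \<delta>s (\<lambda>x. a x * g i x) x) has_sum iter \<delta>s (\<lambda>x. a x * s x) x) I"
    using assms
  proof (induction \<delta>s arbitrary: a g s rule: rev_induct)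
    case Nil
    then show ?case by (simp add: has_sum_cmult_right tsum_has_sum)
  next
    case (snoc \<delta> \<delta>s)
    have \<delta>: "der \<delta>" and \<delta>s: "set \<delta>s \<subseteq> Collect der"
      using snoc.prems by auto
    have leibniz: "iter \<delta>s (\<delta> (\<lambda>x. a x * h x)) x
        = iter \<delta>s (\<lambda>x. \<delta> a x * h x) x + iter \<delta>s (\<lambda>x. a x * \<delta> h x) x" if "h \<in> F" for h
    proof -
      have *: "(\<lambda>x. \<delta> a x * h x) \<in> F" "(\<lambda>x. a x * \<delta> h x) \<in> F"
        using snoc.prems(3) that by (simp_all add: mult_mem der_mem[OF \<delta>])
      have "iter \<delta>s (\<delta> (\<lambda>x. a x * h x)) x = iter \<delta>s (\<lambda>x. \<delta> a x * h x + a x * \<delta> h x) x"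
        using der_mult[OF \<delta> snoc.prems(3) that] snoc.prems(2)
        by (rule iter_cong[OF \<delta>s add_mem[OF *]])
      then show ?thesis
        using iter_add[OF \<delta>s * \<open>x \<in> U\<close>] by simp
    qed
    note sums = has_sum_add[OF snoc.IH[OF \<delta>s snoc.prems(2) der_mem[OF \<delta> snoc.prems(3)] snoc.prems(4)]
        snoc.IH[OF \<delta>s snoc.prems(2,3) tsum_der[OF snoc.prems(4) \<delta>]]]
    show ?case
      by (rule has_sum_transform[OF sums])
        (simp_all add: leibniz[OF tsum_mem[OF snoc.prems(4)]] leibniz[OF tsum_term_mem[OF snoc.prems(4)]])
  qed
qed (use assms in \<open>simp_all add: mult_mem tsum_mem[OF assms(2)] tsum_term_mem[OF assms(2)]\<close>)

lemma tsum_minus: "tsum I g s \<Longrightarrow> tsum I (\<lambda>i x. - g i x) (\<lambda>x. - s x)"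
  using tsum_mult[of "\<lambda>x. -1" I g s] by simp

lemma tsum_diff:
  "tsum I g s \<Longrightarrow> tsum I h t \<Longrightarrow> tsum I (\<lambda>i x. g i x - h i x) (\<lambda>x. s x - t x)"
  using tsum_add[of I g s "\<lambda>i x. - h i x" "\<lambda>x. - t x"] tsum_minus[of I h t] by simp

lemma iter_zero: "set \<delta>s \<subseteq> Collect der \<Longrightarrow> x \<in> U \<Longrightarrow> iter \<delta>s (\<lambda>x. 0) x = 0"
  using iter_add[of \<delta>s "\<lambda>x. 0" "\<lambda>x. 0" x] by simp

lemma tsum_reindex:
  assumes "inj_on \<phi> I" "tsum I g s" "\<And>i. i \<in> I \<Longrightarrow> g' (\<phi> i) = g i"
  shows "tsum (\<phi> ` I) g' s"
proof (rule tsumI)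
  fix \<delta>s :: "(('p \<Rightarrow> real) \<Rightarrow> 'p \<Rightarrow> real) list" and x
  assume *: "set \<delta>s \<subseteq> Collect der" "x \<in> U"
  show "((\<lambda>i. iter \<delta>s (g' i) x) has_sum iter \<delta>s s x) (\<phi> ` I)"
    unfolding has_sum_reindex[OF assms(1)] o_def
    by (rule has_sum_transform[OF tsum_iter[OF assms(2) *]]) (simp_all add: assms(3))
qed (use tsum_mem[OF assms(2)] tsum_term_mem[OF assms(2)] assms(3) in \<open>auto\<close>)

lemma tsum_extend:
  assumes "tsum I g s" "I \<subseteq> J" "\<And>i x. i \<in> J - I \<Longrightarrow> x \<in> U \<Longrightarrow> g i x = 0"
  shows "tsum J g s"
proof (rule tsumI)
  fix \<delta>s :: "(('p \<Rightarrow> real) \<Rightarrow> 'p \<Rightarrow> real) list" and x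
  assume *: "set \<delta>s \<subseteq> Collect der" "x \<in> U"
  have "iter \<delta>s (g i) x = 0" if "i \<in> J - I" for i
    using iter_cong[OF *(1) const_mem, of "g i" 0 x] assms(3)[OF that] iter_zero[OF *] *(2) by simp
  moreover have "iter \<delta>s (g i) x = 0" if "i \<in> I - J" for i
    using that assms(2) by blast
  ultimately show "((\<lambda>i. iter \<delta>s (g i) x) has_sum iter \<delta>s s x) J"
    using has_sum_cong_neutral[of I J "\<lambda>i. iter \<delta>s (g i) x" "\<lambda>i. iter \<delta>s (g i) x"]
      tsum_iter[OF assms(1) *] by simp
next
  fix i assume "i \<in> J"
  then show "g i \<in> F"
    using tsum_term_mem[OF assms(1), of i] mem_cong[OF const_mem[of 0], of "g i"] assms(3)[of i]
    by (cases "i \<in> I") auto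
qed (use assms tsum_mem in auto)

lemma tsum_single: "s \<in> F \<Longrightarrow> tsum {i} (\<lambda>_. s) s"
  by (intro tsumI) (auto intro: has_sum_finiteI)

text \<open>Each rule passes from the summands to the total by uniqueness of sums. In this way the
  correction term of the Dirac bracket may be used wherever termwise sums accept a
  derivation.\<close>

lemma der_tsum:
  assumes "\<And>i. i \<in> I \<Longrightarrow> der (\<delta> i)" "\<And>g. g \<in> F \<Longrightarrow> tsum I (\<lambda>i. \<delta> i g) (\<epsilon> g)"
  shows "der \<epsilon>"
proof -
  have hs: "((\<lambda>i. \<delta> i g x) has_sum \<epsilon> g x) I" if "g \<in> F" "x \<in> U" for g x
    using tsum_has_sum[OF assms(2)] that by blast
  have unique: "\<epsilon> g x = c" if "g \<in> F" "x \<in> U" "((\<lambda>i. \<delta> i g x) has_sum c) I" for g x c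
    using hs[OF that(1,2)] that(3) has_sum_unique by blast
  show ?thesis
  proof (rule derI)
    fix f assume "f \<in> F"
    then show "\<epsilon> f \<in> F" using assms(2) tsum_mem by blast
  next
    fix f g x assume f: "f \<in> F" and g: "g \<in> F" and eq: "\<And>y. y \<in> U \<Longrightarrow> f y = g y" and x: "x \<in> U"
    have "\<delta> i g x = \<delta> i f x" if "i \<in> I" for i
      using der_cong[OF assms(1)[OF that] g eq x] by simp
    then have "((\<lambda>i. \<delta> i f x) has_sum \<epsilon> g x) I"
      by (intro has_sum_transform[OF hs[OF g x]]) auto
    then show "\<epsilon> f x = \<epsilon> g x"
      by (rule unique[OF f x])
  next
    fix a f x assume f: "f \<in> F" and x: "x \<in> U"
    have "((\<lambda>i. \<delta> i (\<lambda>y. a * f y) x) has_sum a * \<epsilon> f x) I"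
      by (rule has_sum_transform[OF has_sum_cmult_right[OF hs[OF f x], of a]])
        (simp_all add: der_scale[OF assms(1) f x])
    then show "\<epsilon> (\<lambda>y. a * f y) x = a * \<epsilon> f x"
      by (rule unique[OF scale_mem[OF f] x])
  next
    fix f g x assume f: "f \<in> F" and g: "g \<in> F" and x: "x \<in> U"
    have "((\<lambda>i. \<delta> i (\<lambda>y. f y + g y) x) has_sum \<epsilon> f x + \<epsilon> g x) I"
      by (rule has_sum_transform[OF has_sum_add[OF hs[OF f x] hs[OF g x]]])
        (simp_all add: der_add[OF assms(1) f g x])
    then show "\<epsilon> (\<lambda>y. f y + g y) x = \<epsilon> f x + \<epsilon> g x"
      by (rule unique[OF add_mem[OF f g] x])
    have "((\<lambda>i. \<delta> i (\<lambda>y. f y * g y) x) has_sum \<epsilon> f x * g x + f x * \<epsilon> g x) I"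
      by (rule has_sum_transform[OF has_sum_add[OF has_sum_cmult_left[OF hs[OF f x], of "g x"]
              has_sum_cmult_right[OF hs[OF g x], of "f x"]]])
        (simp_all add: der_mult[OF assms(1) f g x])
    then show "\<epsilon> (\<lambda>y. f y * g y) x = \<epsilon> f x * g x + f x * \<epsilon> g x"
      by (rule unique[OF mult_mem[OF f g] x])
  qed
qed

lemma der_prod:
  assumes "finite I" "der \<delta>" "\<And>i. i \<in> I \<Longrightarrow> f i \<in> F" "\<And>i. i \<in> I \<Longrightarrow> \<delta> (f i) x = 0"
    "x \<in> U"
  shows "\<delta> (\<lambda>y. \<Prod>i\<in>I. f i y) x = 0"
  using assms
proof (induction I)
  case (insert i I)
  then have "\<delta> (\<lambda>y. f i y * (\<Prod>i\<in>I. f i y)) x = 0"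
    by (subst der_mult) (auto intro: prod_mem)
  then show ?case
    using insert.hyps by simp
qed (simp add: der_const)

lemma der_divided_power:
  assumes "der \<delta>" "f \<in> F" "x \<in> U"
  shows "\<delta> (\<lambda>y. f y ^ Suc n / fact (Suc n)) x = f x ^ n / fact n * \<delta> f x"
proof -
  have power: "\<delta> (\<lambda>y. f y ^ Suc m) x = real (Suc m) * f x ^ m * \<delta> f x" for m
  proof (induction m)
    case (Suc m)
    have "\<delta> (\<lambda>y. f y * f y ^ Suc m) x = \<delta> f x * f x ^ Suc m + f x * \<delta> (\<lambda>y. f y ^ Suc m) x"
      by (rule der_mult[OF assms(1,2) power_mem[OF assms(2)] assms(3)])
    then show ?case
      using Suc by (simp add: algebra_simps)
  qed simp
  have "\<delta> (\<lambda>y. inverse (fact (Suc n)) * f y ^ Suc n) x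
      = inverse (fact (Suc n)) * \<delta> (\<lambda>y. f y ^ Suc n) x"
    by (rule der_scale[OF assms(1) power_mem[OF assms(2)] assms(3)])
  moreover have "real (Suc n) * inverse (fact (Suc n)) = inverse (fact n)"
    by (simp add: field_simps del: of_nat_Suc)
  ultimately show ?thesis
    unfolding power by (simp add: divide_inverse mult.commute mult.assoc del: of_nat_Suc fact_Suc power_Suc)
qed

end

section \<open>The ideal generated by the constraints\<close>

locale poisson_functions = function_algebra F U
  for F :: "('p \<Rightarrow> real) set" and U :: "'p set" +
  fixes pb :: "('p \<Rightarrow> real) \<Rightarrow> ('p \<Rightarrow> real) \<Rightarrow> 'p \<Rightarrow> real"
  assumes pb_der: "f \<in> F \<Longrightarrow> derivation_on F U (pb f)"
    and pb_antisym: "f \<in> F \<Longrightarrow> g \<in> F \<Longrightarrow> x \<in> U \<Longrightarrow> pb f g x = - pb g f x"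
    and pb_jacobi: "f \<in> F \<Longrightarrow> g \<in> F \<Longrightarrow> h \<in> F \<Longrightarrow> x \<in> U \<Longrightarrow>
      pb f (pb g h) x + pb g (pb h f) x + pb h (pb f g) x = 0"
begin

lemma pb_mem: "f \<in> F \<Longrightarrow> g \<in> F \<Longrightarrow> pb f g \<in> F"
  by (rule der_mem[OF pb_der])

lemma pb_der_left:
  assumes "h \<in> F"
  shows "der (\<lambda>f. pb f h)"
proof (rule derI, goal_cases)
  case (1 f)
  then show ?case using assms by (rule pb_mem)
next
  case (2 f g x)
  then show ?case
    using der_cong[OF pb_der[OF assms], of g f x] assms by (simp add: pb_antisym[of _ h])
qed (use assms in \<open>simp_all add: pb_antisym[of _ h] scale_mem add_mem mult_mem
        der_scale[OF pb_der] der_add[OF pb_der] der_mult[OF pb_der] algebra_simps\<close>)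

lemma pb_leibniz:
  assumes "f \<in> F" "g \<in> F" "h \<in> F" "x \<in> U"
  shows "pb f (pb g h) x = pb (pb f g) h x + pb g (pb f h) x"
proof -
  have "pb g (pb h f) x = pb g (\<lambda>y. - pb f h y) x"
    using minus_mem[OF pb_mem[OF assms(1,3)]] pb_antisym[OF assms(3,1)] assms(4)
    by (rule der_cong[OF pb_der[OF assms(2)]])
  also have "\<dots> = - pb g (pb f h) x"
    by (rule der_minus[OF pb_der[OF assms(2)] pb_mem[OF assms(1,3)] assms(4)])
  finally show ?thesis
    using pb_jacobi[OF assms] pb_antisym[OF assms(3) pb_mem[OF assms(1,2)] assms(4)] by simp
qed

end

text \<open>
  The index type in the last rule is only a device: it is large enough for every family of sums that
  occurs, since an inductive definition cannot range over all index types.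
\<close>

inductive_set constraint_ideal ::
  "('p \<Rightarrow> real) set \<Rightarrow> 'p set \<Rightarrow> ('j \<Rightarrow> 'p \<Rightarrow> real) \<Rightarrow> ('p \<Rightarrow> real) set"
  for F :: "('p \<Rightarrow> real) set" and U :: "'p set" and C :: "'j \<Rightarrow> 'p \<Rightarrow> real" where
  gen: "C i \<in> constraint_ideal F U C"
| mult: "a \<in> F \<Longrightarrow> u \<in> constraint_ideal F U C \<Longrightarrow> (\<lambda>x. a x * u x) \<in> constraint_ideal F U C"
| add: "u \<in> constraint_ideal F U C \<Longrightarrow> v \<in> constraint_ideal F U C \<Longrightarrow>
    (\<lambda>x. u x + v x) \<in> constraint_ideal F U C"
| sum: "termwise_sum F U I g s \<Longrightarrow>
    (\<And>i :: ('j \<Rightarrow> nat) + ('j + 'j) \<times> ('j + 'j). i \<in> I \<Longrightarrow> g i \<in> constraint_ideal F U C) \<Longrightarrow>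
    s \<in> constraint_ideal F U C"

locale constrained_system = poisson_functions F U pb
  for F :: "('p \<Rightarrow> real) set" and U :: "'p set" and pb +
  fixes H :: "'j \<Rightarrow> 'p \<Rightarrow> real"
  assumes H_first_class: "first_class pb F U H"
begin

abbreviation \<I> where "\<I> \<equiv> constraint_ideal F U H"
abbreviation S where "S \<equiv> zero_set H \<inter> U"

lemma H_mem: "H i \<in> F"
  using H_first_class by (simp add: first_class_def)

lemma ideal_mem: "u \<in> \<I> \<Longrightarrow> u \<in> F"
proof (induction rule: constraint_ideal.induct)
  case (sum I g s)
  show ?case by (rule tsum_mem[OF sum.hyps(1)])
qed (simp_all add: H_mem mult_mem add_mem)

lemma ideal_vanish: "u \<in> \<I> \<Longrightarrow> x \<in> S \<Longrightarrow> u x = 0"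
proof (induction rule: constraint_ideal.induct)
  case (sum I g s)
  then have "((\<lambda>i. g i x) has_sum 0) I"
    by (intro has_sum_0) auto
  with tsum_has_sum[OF sum.hyps(1)] sum.prems show ?case
    using has_sum_unique by blast
qed (auto simp: zero_set_def)

lemma ideal_sum:
  fixes \<phi> :: "'i \<Rightarrow> ('j \<Rightarrow> nat) + ('j + 'j) \<times> ('j + 'j)"
  assumes "inj \<phi>" "tsum I g s" "\<And>i :: 'i. i \<in> I \<Longrightarrow> g i \<in> \<I>"
  shows "s \<in> \<I>"
proof (rule constraint_ideal.sum)
  show "tsum (\<phi> ` I) (\<lambda>i. g (inv \<phi> i)) s"
    using assms by (intro tsum_reindex) (auto intro: inj_on_subset)
qed (use assms in auto)

lemmas ideal_sum_multi_index = ideal_sum[of Inl, OF inj_Inl]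
  and ideal_sum_pair = ideal_sum[of Inr, OF inj_Inr]

lemma ideal_sum_index:
  assumes "tsum I g s" "\<And>i :: 'j. i \<in> I \<Longrightarrow> g i \<in> \<I>"
  shows "s \<in> \<I>"
  by (rule ideal_sum[of "\<lambda>i. Inr (Inl i, Inl i)", OF _ assms]) (simp_all add: inj_def)

text \<open>Changing values outside \<open>U\<close> needs no rule of its own in the inductive
  definition: the value of a one-term sum may be any function that agrees with the term on
  \<open>U\<close>.\<close>

lemma ideal_cong:
  assumes "u \<in> \<I>" "\<And>x. x \<in> U \<Longrightarrow> v x = u x"
  shows "v \<in> \<I>"
proof (rule ideal_sum_index)
  show "tsum {undefined} (\<lambda>_. u) v"
    using assms by (intro tsum_cong[OF tsum_single]) (auto intro: ideal_mem)
qed (use assms in simp)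

lemma ideal_zero: "(\<lambda>x. 0) \<in> \<I>"
  using constraint_ideal.mult[OF const_mem[of 0] constraint_ideal.gen] by simp

lemma ideal_scale: "u \<in> \<I> \<Longrightarrow> (\<lambda>x. a * u x) \<in> \<I>"
  by (rule constraint_ideal.mult[OF const_mem])

lemma ideal_minus: "u \<in> \<I> \<Longrightarrow> (\<lambda>x. - u x) \<in> \<I>"
  using ideal_scale[of u "-1"] by simp

lemma ideal_add: "u \<in> \<I> \<Longrightarrow> v \<in> \<I> \<Longrightarrow> (\<lambda>x. u x + v x) \<in> \<I>"
  by (rule constraint_ideal.add)

lemma ideal_der:
  assumes "der \<delta>" "\<And>i. \<delta> (H i) \<in> \<I>"
  shows "u \<in> \<I> \<Longrightarrow> \<delta> u \<in> \<I>"
proof (induction rule: constraint_ideal.induct)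
  case (gen i)
  show ?case by (rule assms(2))
next
  case (mult a u)
  have "(\<lambda>x. \<delta> a x * u x + a x * \<delta> u x) \<in> \<I>"
    using mult der_mem[OF assms(1)] by (intro ideal_add constraint_ideal.mult) auto
  then show ?case
    using der_mult[OF assms(1) mult(1) ideal_mem[OF mult(2)]] by (rule ideal_cong)
next
  case (add u v)
  then have "(\<lambda>x. \<delta> u x + \<delta> v x) \<in> \<I>"
    by (intro ideal_add)
  then show ?case
    using der_add[OF assms(1) add(1,2)[THEN ideal_mem]] by (rule ideal_cong)
next
  case (sum I g s)
  show ?case
    by (rule constraint_ideal.sum[OF tsum_der[OF sum(1) assms(1)]]) (rule sum.IH)
qed

text \<open>In \<open>\<delta> a x * u x + a x * \<delta> u x\<close> the first summand vanishes
  because \<open>u\<close> is zero on \<open>S\<close>, so information at the single point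
  \<open>x\<close> suffices. This is the form that suits observables, where \<open>ideal_der\<close>
  would ask for ideal membership.\<close>

lemma ideal_der_vanish:
  assumes "der \<delta>" "x \<in> S" "\<And>i. \<delta> (H i) x = 0"
  shows "u \<in> \<I> \<Longrightarrow> \<delta> u x = 0"
proof (induction rule: constraint_ideal.induct)
  case (mult a u)
  then show ?case
    using assms(2) by (simp add: der_mult[OF assms(1)] ideal_mem ideal_vanish)
next
  case (add u v)
  then show ?case
    using assms(2) by (simp add: der_add[OF assms(1)] ideal_mem)
next
  case (sum I g s)
  have "((\<lambda>i. \<delta> (g i) x) has_sum \<delta> s x) I"
    using tsum_has_sum[OF tsum_der[OF sum(1) assms(1)]] assms(2) by blast
  moreover have "((\<lambda>i. \<delta> (g i) x) has_sum 0) I"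
    by (intro has_sum_0) (rule sum.IH)
  ultimately show ?case by (rule has_sum_unique)
qed (rule assms(3))

lemma pb_H_H: "pb (H i) (H j) \<in> \<I>"
proof -
  obtain s where s: "\<And>k. s k \<in> F" "tsum UNIV (\<lambda>k x. s k x * H k x) (pb (H i) (H j))"
    using H_first_class unfolding first_class_def by blast
  show ?thesis
    by (rule ideal_sum_index[OF s(2)]) (rule constraint_ideal.mult[OF s(1) constraint_ideal.gen])
qed

lemma pb_H_ideal: "u \<in> \<I> \<Longrightarrow> pb (H i) u \<in> \<I>"
  by (rule ideal_der[OF pb_der[OF H_mem] pb_H_H])

lemma pb_ideal_ideal:
  assumes "u \<in> \<I>" "v \<in> \<I>"
  shows "pb u v \<in> \<I>"
proof (rule ideal_der[OF pb_der[OF ideal_mem[OF assms(1)]] _ assms(2)])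
  show "pb u (H i) \<in> \<I>" for i
    using ideal_minus[OF pb_H_ideal[OF assms(1), of i]]
      pb_antisym[OF ideal_mem[OF assms(1)] H_mem] by (rule ideal_cong)
qed

abbreviation Obs where "Obs \<equiv> weak_observables pb F U H"

lemma Obs_iff: "f \<in> Obs \<longleftrightarrow> f \<in> F \<and> (\<forall>x\<in>S. \<forall>i. pb (H i) f x = 0)"
  by (auto simp: weak_observables_def weakly_eq_def)

lemma pb_observable_ideal:
  assumes "f \<in> Obs" "u \<in> \<I>" "x \<in> S"
  shows "pb f u x = 0"
proof (rule ideal_der_vanish[OF pb_der assms(3) _ assms(2)])
  show "f \<in> F" using assms(1) by (simp add: Obs_iff)
  then show "pb f (H i) x = 0" for i
    using assms pb_antisym[OF _ H_mem, of f x i] by (simp add: Obs_iff)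
qed

text \<open>Finer than equality on \<open>S\<close>: the fields {\<open>H' j\<close>, .} respect
  this congruence, while nothing ensures that they respect weak equality. Both memberships in
  \<open>F\<close> are included because the derivation rules ask for them.\<close>

definition ideal_eq :: "('p \<Rightarrow> real) \<Rightarrow> ('p \<Rightarrow> real) \<Rightarrow> bool" (infix "\<sim>" 50) where
  "f \<sim> g \<longleftrightarrow> f \<in> F \<and> g \<in> F \<and> (\<lambda>x. f x - g x) \<in> \<I>"

lemma ideal_eq_memD: "f \<sim> g \<Longrightarrow> f \<in> F" "f \<sim> g \<Longrightarrow> g \<in> F"
  by (simp_all add: ideal_eq_def)

lemma ideal_eq_weak: "f \<sim> g \<Longrightarrow> x \<in> S \<Longrightarrow> f x = g x"
  using ideal_vanish[of "\<lambda>x. f x - g x" x] by (simp add: ideal_eq_def)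

lemma ideal_eq_cong: "f \<in> F \<Longrightarrow> (\<And>x. x \<in> U \<Longrightarrow> g x = f x) \<Longrightarrow> f \<sim> g"
  unfolding ideal_eq_def using mem_cong[of f g] ideal_cong[OF ideal_zero, of "\<lambda>x. f x - g x"] by simp

lemma ideal_eq_refl: "f \<in> F \<Longrightarrow> f \<sim> f"
  by (rule ideal_eq_cong) simp_all

lemma ideal_eq_sym: "f \<sim> g \<Longrightarrow> g \<sim> f"
  unfolding ideal_eq_def using ideal_minus[of "\<lambda>x. f x - g x"] by simp

lemma ideal_eq_add: "f \<sim> g \<Longrightarrow> f' \<sim> g' \<Longrightarrow> (\<lambda>x. f x + f' x) \<sim> (\<lambda>x. g x + g' x)"
  unfolding ideal_eq_def
  using ideal_add[of "\<lambda>x. f x - g x" "\<lambda>x. f' x - g' x"]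
  by (simp add: add_mem algebra_simps)

lemma ideal_eq_trans [trans]: "f \<sim> g \<Longrightarrow> g \<sim> h \<Longrightarrow> f \<sim> h"
  unfolding ideal_eq_def
  using ideal_add[of "\<lambda>x. f x - g x" "\<lambda>x. g x - h x"] by simp

lemma ideal_eq_mult:
  assumes "f \<sim> g" "f' \<sim> g'"
  shows "(\<lambda>x. f x * f' x) \<sim> (\<lambda>x. g x * g' x)"
proof -
  have "(\<lambda>x. f' x * (f x - g x) + g x * (f' x - g' x)) \<in> \<I>"
    using assms unfolding ideal_eq_def by (intro ideal_add constraint_ideal.mult) auto
  then show ?thesis
    using assms unfolding ideal_eq_def by (simp add: mult_mem algebra_simps)
qed

lemma ideal_eq_der:
  assumes "der \<delta>" "\<And>u. u \<in> \<I> \<Longrightarrow> \<delta> u \<in> \<I>" "f \<sim> g"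
  shows "\<delta> f \<sim> \<delta> g"
proof -
  have "\<delta> (\<lambda>x. f x - g x) \<in> \<I>"
    using assms(2,3) by (simp add: ideal_eq_def)
  then have "(\<lambda>x. \<delta> f x - \<delta> g x) \<in> \<I>"
    by (rule ideal_cong) (simp add: der_diff[OF assms(1) ideal_eq_memD[OF assms(3)]])
  then show ?thesis
    using assms(3) der_mem[OF assms(1)] by (simp add: ideal_eq_def)
qed

lemma ideal_eq_zeroI: "u \<in> \<I> \<Longrightarrow> u \<sim> (\<lambda>x. 0)"
  by (simp add: ideal_eq_def ideal_mem)

lemma ideal_eq_zeroD: "f \<sim> (\<lambda>x. 0) \<Longrightarrow> f \<in> \<I>"
  by (simp add: ideal_eq_def)

lemma der_prod_ideal:
  assumes "finite I" "der \<delta>" "\<And>i. i \<in> I \<Longrightarrow> f i \<in> F" "\<And>i. i \<in> I \<Longrightarrow> \<delta> (f i) \<in> \<I>"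
  shows "\<delta> (\<lambda>y. \<Prod>i\<in>I. f i y) \<in> \<I>"
  using assms(1,3,4)
proof (induction I)
  case empty
  show ?case
    by (rule ideal_cong[OF ideal_zero]) (simp add: der_const[OF assms(2)])
next
  case (insert i I)
  have mem: "f i \<in> F" "(\<lambda>y. \<Prod>i\<in>I. f i y) \<in> F"
    using insert.prems by (auto intro: prod_mem)
  have "(\<lambda>y. (\<Prod>i\<in>I. f i y) * \<delta> (f i) y + f i y * \<delta> (\<lambda>y. \<Prod>i\<in>I. f i y) y) \<in> \<I>"
    using insert mem by (intro ideal_add constraint_ideal.mult) auto
  then have "\<delta> (\<lambda>y. f i y * (\<Prod>i\<in>I. f i y)) \<in> \<I>"
    by (rule ideal_cong) (simp add: der_mult[OF assms(2) mem])
  then show ?case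
    using insert.hyps by simp
qed

end

section \<open>Words of Hamiltonian vector fields\<close>

text \<open>Spelling the iterated field out as one list turns reordering of the fields into equality
  of multisets.\<close>

definition word :: "('j::linorder \<Rightarrow> nat) \<Rightarrow> 'j list" where
  "word k = concat (map (\<lambda>j. replicate (k j) j) (sorted_list_of_set {j. k j \<noteq> 0}))"

lemma chi_multi_word: "chi_multi pb G k f = foldr (\<lambda>j. pb (G j)) (word k) f"
proof -
  have power: "foldr g (replicate n j) f = (g j ^^ n) f" for g :: "'a \<Rightarrow> 'b \<Rightarrow> 'b" and n j f
    by (induction n) auto
  have "foldr (\<lambda>j. pb (G j) ^^ k j) xs f
      = foldr (\<lambda>j. pb (G j)) (concat (map (\<lambda>j. replicate (k j) j) xs)) f" for xs
    by (induction xs) (simp_all add: power)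
  then show ?thesis
    by (simp add: chi_multi_def word_def)
qed

lemma count_word:
  assumes "k \<in> multi_indices"
  shows "count (mset (word k)) j = k j"
proof -
  have "count (mset (concat (map (\<lambda>j. replicate (k j) j) xs))) j = (if j \<in> set xs then k j else 0)"
    if "distinct xs" for xs
    using that by (induction xs) auto
  then show ?thesis
    using assms by (simp add: word_def multi_indices_def)
qed

lemma multi_indices_update [simp]: "k(j := n) \<in> multi_indices \<longleftrightarrow> k \<in> multi_indices"
proof -
  have "finite {i. (k(j := n)) i \<noteq> 0} \<longleftrightarrow> finite {i. k i \<noteq> 0}"
  proof
    assume "finite {i. (k(j := n)) i \<noteq> 0}"
    then show "finite {i. k i \<noteq> 0}"
      by (rule rev_finite_subset[OF finite.insertI[of _ j]]) auto
  next
    assume "finite {i. k i \<noteq> 0}"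
    then show "finite {i. (k(j := n)) i \<noteq> 0}"
      by (rule rev_finite_subset[OF finite.insertI[of _ j]]) auto
  qed
  then show ?thesis by (simp only: multi_indices_def mem_Collect_eq)
qed

definition monomial :: "('j \<Rightarrow> 'p \<Rightarrow> real) \<Rightarrow> ('j \<Rightarrow> nat) \<Rightarrow> 'p \<Rightarrow> real" where
  "monomial B k x = (\<Prod>j | k j \<noteq> 0. B j x ^ k j / fact (k j))"

lemma projector_term_monomial:
  "projector_term pb B G f k = (\<lambda>x. monomial B k x * foldr (\<lambda>j. pb (G j)) (word k) f x)"
  by (simp add: projector_term_def monomial_def chi_multi_word)

text \<open>The factor of \<open>j\<close> is split off and the remaining product does not depend on
  \<open>n\<close>, so \<open>k\<close> and its predecessor in direction \<open>j\<close> share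
  it.\<close>

lemma monomial_update:
  assumes "k \<in> multi_indices"
  shows "monomial B (k(j := n)) x
    = B j x ^ n / fact n * (\<Prod>i\<in>{i. k i \<noteq> 0} - {j}. B i x ^ k i / fact (k i))"
proof -
  let ?k = "k(j := n)"
  have "monomial B ?k x = (\<Prod>i\<in>insert j {i. k i \<noteq> 0}. B i x ^ ?k i / fact (?k i))"
    unfolding monomial_def using assms
    by (intro prod.mono_neutral_left) (auto simp: multi_indices_def split: if_splits)
  also have "\<dots> = B j x ^ n / fact n * (\<Prod>i\<in>{i. k i \<noteq> 0} - {j}. B i x ^ ?k i / fact (?k i))"
    using assms by (subst prod.insert_remove) (auto simp: multi_indices_def)
  also have "(\<Prod>i\<in>{i. k i \<noteq> 0} - {j}. B i x ^ ?k i / fact (?k i))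
      = (\<Prod>i\<in>{i. k i \<noteq> 0} - {j}. B i x ^ k i / fact (k i))"
    by (rule prod.cong) auto
  finally show ?thesis .
qed

section \<open>Mutually gauge fixing constraint families\<close>

text \<open>Geometry enters only through \<open>flow\<close>, which keeps the points of a curve and
  the exponential series along it. \<open>M_N\<close> is the identity M N = 1; for the exchanged
  pair the same clause becomes N M = 1, transposed.\<close>

locale constraint_pair = constrained_system F U pb H
  for F :: "('p \<Rightarrow> real) set" and U :: "'p set" and pb and H :: "'j::linorder \<Rightarrow> 'p \<Rightarrow> real" +
  fixes D :: "'j \<Rightarrow> 'p \<Rightarrow> real" and H' :: "'j \<Rightarrow> 'p \<Rightarrow> real"
    and N :: "'j \<Rightarrow> 'j \<Rightarrow> 'p \<Rightarrow> real" and E :: "'j + 'j \<Rightarrow> 'j + 'j \<Rightarrow> 'p \<Rightarrow> real"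
    and P :: "('p \<Rightarrow> real) \<Rightarrow> 'p \<Rightarrow> real"
  assumes D_mem: "D i \<in> F"
    and N_mem: "N i j \<in> F"
    and M_N: "termwise_sum F U UNIV (\<lambda>j x. pb (D i) (H j) x * N j k x) (\<lambda>x. if i = k then 1 else 0)"
    and H'_sum: "termwise_sum F U UNIV (\<lambda>i x. N i j x * H i x) (H' j)"
    and E_inverse: "matrix_inverse F U (\<lambda>a b. pb (combined D H a) (combined D H b)) E"
    and dirac_sum: "f \<in> F \<Longrightarrow> g \<in> F \<Longrightarrow> termwise_sum F U UNIV (dirac_term pb (combined D H) E f g)
      (\<lambda>x. \<Sum>\<^sub>\<infinity>ab. dirac_term pb (combined D H) E f g ab x)"
    and P_sum: "f \<in> F \<Longrightarrow> termwise_sum F U multi_indices (projector_term pb D H' f) (P f)"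
    and flow: "x \<in> zero_set H \<inter> U \<Longrightarrow> \<exists>\<beta> h \<gamma>.
      termwise_sum F U UNIV (\<lambda>j z. \<beta> j * H' j z) h \<and>
      (\<forall>t\<in>{0..1}. \<gamma> t \<in> U) \<and> \<gamma> 1 \<in> zero_set D \<and>
      (\<forall>f\<in>F. \<forall>t\<in>{0..1::real}. (\<lambda>n. t ^ n / fact n * (pb h ^^ n) f x) sums f (\<gamma> t))"
begin

abbreviation C where "C \<equiv> combined D H"
abbreviation DB where "DB \<equiv> dirac_bracket pb C E"

lemma C_simps [simp]: "C (Inl i) = D i" "C (Inr i) = H i"
  by (simp_all add: combined_def)

lemma C_mem: "C a \<in> F"
  by (cases a) (simp_all add: D_mem H_mem)

lemma E_mem: "E a b \<in> F"
  and E_right: "tsum UNIV (\<lambda>b x. pb (C a) (C b) x * E b c x) (\<lambda>x. if a = c then 1 else 0)"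
  and E_left: "tsum UNIV (\<lambda>b x. E a b x * pb (C b) (C c) x) (\<lambda>x. if a = c then 1 else 0)"
  using E_inverse by (auto simp: matrix_inverse_def)

section \<open>The Dirac bracket annihilates the constraints and preserves the ideal\<close>

lemma dirac_term_apply: "dirac_term pb C E f g (a, b) x = pb f (C a) x * E a b x * pb (C b) g x"
  by (simp add: dirac_term_def)

lemma DB_der:
  assumes "f \<in> F"
  shows "der (DB f)"
proof -
  have "der (\<lambda>g. dirac_term pb C E f g ab)" for ab
  proof (cases ab)
    case (Pair a b)
    have "der (\<lambda>g x. (pb f (C a) x * E a b x) * pb (C b) g x)"
      by (intro der_scaled mult_mem pb_mem E_mem assms C_mem pb_der)
    then show ?thesis
      by (simp add: Pair dirac_term_def)
  qed
  then have "der (\<lambda>g x. pb f g x - (\<Sum>\<^sub>\<infinity>ab. dirac_term pb C E f g ab x))"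
    by (intro der_subtract pb_der assms der_tsum[OF _ dirac_sum[OF assms]])
  then show ?thesis
    by (simp add: dirac_bracket_def[abs_def])
qed

text \<open>Antisymmetry of \<open>DB\<close> would require that of \<open>E\<close>, which is not
  immediate for infinite matrices, where inverses need not be unique. The left slot is therefore
  treated directly.\<close>

lemma DB_der_left:
  assumes "g \<in> F"
  shows "der (\<lambda>f. DB f g)"
proof -
  have "der (\<lambda>f. dirac_term pb C E f g ab)" for ab
  proof (cases ab)
    case (Pair a b)
    have "der (\<lambda>f x. (E a b x * pb (C b) g x) * pb f (C a) x)"
      by (intro der_scaled mult_mem pb_mem E_mem assms C_mem pb_der_left)
    then show ?thesis
      by (simp add: Pair dirac_term_def mult_ac)
  qed
  then have "der (\<lambda>f x. pb f g x - (\<Sum>\<^sub>\<infinity>ab. dirac_term pb C E f g ab x))"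
    by (intro der_subtract pb_der_left assms der_tsum[OF _ dirac_sum[OF _ assms]])
  then show ?thesis
    by (simp add: dirac_bracket_def[abs_def])
qed

lemma DB_mem: "f \<in> F \<Longrightarrow> g \<in> F \<Longrightarrow> DB f g \<in> F"
  by (rule der_mem[OF DB_der])

lemma has_sum_dirac:
  "f \<in> F \<Longrightarrow> g \<in> F \<Longrightarrow> x \<in> U \<Longrightarrow>
    ((\<lambda>ab. dirac_term pb C E f g ab x) has_sum (pb f g x - DB f g x)) UNIV"
  using tsum_has_sum[OF dirac_sum] by (simp add: dirac_bracket_def)

text \<open>The double sum converges unconditionally, so either index may be summed first. Summing
  over \<open>b\<close> meets \<open>E_left\<close> and collapses at once; in the mirrored
  \<open>DB_C_left\<close> one sums over \<open>a\<close> and meets \<open>E_right\<close>. No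
  associativity of matrix products is involved.\<close>

lemma DB_C:
  assumes "f \<in> F" "x \<in> U"
  shows "DB f (C c) x = 0"
proof -
  have "((\<lambda>b. pb f (C a) x * (E a b x * pb (C b) (C c) x)) has_sum
      pb f (C a) x * (if a = c then 1 else 0)) UNIV" for a
    by (rule has_sum_cmult_right[OF tsum_has_sum[OF E_left assms(2)]])
  then have "((\<lambda>a. pb f (C a) x * (if a = c then 1 else 0)) has_sum (pb f (C c) x - DB f (C c) x)) UNIV"
    by (intro has_sum_pair_left[OF has_sum_dirac[OF assms(1) C_mem assms(2)]])
      (simp add: dirac_term_apply mult.assoc)
  moreover have "((\<lambda>a. pb f (C a) x * (if a = c then 1 else 0)) has_sum
      pb f (C c) x * (if c = c then 1 else 0)) UNIV"
    by (rule has_sum_single_index) simp_all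
  ultimately have "pb f (C c) x - DB f (C c) x = pb f (C c) x * (if c = c then 1 else 0)"
    by (rule has_sum_unique)
  then show ?thesis by simp
qed

lemma DB_C_left:
  assumes "g \<in> F" "x \<in> U"
  shows "DB (C c) g x = 0"
proof -
  have "((\<lambda>a. pb (C c) (C a) x * E a b x * pb (C b) g x) has_sum
      (if c = b then 1 else 0) * pb (C b) g x) UNIV" for b
    by (rule has_sum_cmult_left[OF tsum_has_sum[OF E_right assms(2)]])
  then have "((\<lambda>b. (if c = b then 1 else 0) * pb (C b) g x) has_sum (pb (C c) g x - DB (C c) g x)) UNIV"
    by (intro has_sum_pair_right[OF has_sum_dirac[OF C_mem assms]])
      (simp add: dirac_term_apply)
  moreover have "((\<lambda>b. (if c = b then 1 else 0) * pb (C b) g x) has_sum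
      (if c = c then 1 else 0) * pb (C c) g x) UNIV"
    by (rule has_sum_single_index) simp_all
  ultimately have "pb (C c) g x - DB (C c) g x = (if c = c then 1 else 0) * pb (C c) g x"
    by (rule has_sum_unique)
  then show ?thesis by simp
qed

lemma DB_ideal:
  assumes "f \<in> F" "u \<in> \<I>"
  shows "DB f u \<in> \<I>"
proof (rule ideal_der[OF DB_der[OF assms(1)] _ assms(2)])
  show "DB f (H i) \<in> \<I>" for i
    by (rule ideal_cong[OF ideal_zero]) (use DB_C[OF assms(1), of _ "Inr i"] in simp)
qed

text \<open>
  The Dirac bracket preserves the ideal, and its correction term involves \<open>u\<close> only through brackets
  with the constraints.
\<close>

lemma pb_ideal_second_order:
  assumes "f \<in> F" "u \<in> \<I>" "\<And>i. pb (D i) u \<in> \<I>"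
  shows "pb f u \<in> \<I>"
proof -
  have "(\<lambda>x. \<Sum>\<^sub>\<infinity>ab. dirac_term pb C E f u ab x) \<in> \<I>"
  proof (rule ideal_sum_pair[OF dirac_sum[OF assms(1) ideal_mem[OF assms(2)]]])
    fix ab :: "('j + 'j) \<times> ('j + 'j)"
    obtain a b where ab: "ab = (a, b)" by fastforce
    have "pb (C b) u \<in> \<I>"
      by (cases b) (simp_all add: assms(3) pb_H_ideal[OF assms(2)])
    then have "(\<lambda>x. (pb f (C a) x * E a b x) * pb (C b) u x) \<in> \<I>"
      by (intro constraint_ideal.mult mult_mem pb_mem assms(1) C_mem E_mem)
    then show "dirac_term pb C E f u ab \<in> \<I>"
      by (simp add: dirac_term_def ab)
  qed
  from ideal_add[OF DB_ideal[OF assms(1,2)] this] show ?thesis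
    by (simp add: dirac_bracket_def)
qed

section \<open>The abelianised constraints and their commuting fields\<close>

lemma H'_ideal: "H' j \<in> \<I>"
  by (rule ideal_sum_index[OF H'_sum]) (intro constraint_ideal.mult N_mem constraint_ideal.gen)

lemma H'_mem: "H' j \<in> F"
  by (rule ideal_mem[OF H'_ideal])

lemma pb_H'_ideal: "u \<in> \<I> \<Longrightarrow> pb (H' j) u \<in> \<I>"
  by (rule pb_ideal_ideal[OF H'_ideal])

lemma pb_H'_eq: "f \<sim> g \<Longrightarrow> pb (H' j) f \<sim> pb (H' j) g"
  by (rule ideal_eq_der[OF pb_der[OF H'_mem] pb_H'_ideal])

text \<open>The bracket of \<open>D i\<close> with the \<open>k\<close>-th term of
  \<open>H' j\<close> is {\<open>D i\<close>, \<open>N k j\<close>} \<open>H k\<close> +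
  {\<open>D i\<close>, \<open>H k\<close>} \<open>N k j\<close>. The second parts sum to the
  Kronecker delta by \<open>M_N\<close>, and the first parts lie in the ideal.\<close>

lemma pb_D_H': "pb (D i) (H' j) \<sim> (\<lambda>x. if i = j then 1 else 0)"
proof -
  have "(\<lambda>x. pb (D i) (H' j) x - (if i = j then 1 else 0)) \<in> \<I>"
  proof (rule ideal_sum_index[OF tsum_diff[OF tsum_der[OF H'_sum pb_der[OF D_mem]] M_N]])
    fix k
    have "(\<lambda>x. pb (D i) (N k j) x * H k x) \<in> \<I>"
      by (intro constraint_ideal.mult constraint_ideal.gen pb_mem D_mem N_mem)
    then show "(\<lambda>x. pb (D i) (\<lambda>x. N k j x * H k x) x - pb (D i) (H k) x * N k j x) \<in> \<I>"
      by (rule ideal_cong) (simp add: der_mult[OF pb_der[OF D_mem] N_mem H_mem])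
  qed
  then show ?thesis
    by (simp add: ideal_eq_def pb_mem D_mem H'_mem)
qed

lemma pb_H'_D: "pb (H' j) (D i) \<sim> (\<lambda>x. - (if i = j then 1 else 0))"
proof -
  have "pb (H' j) (D i) \<sim> (\<lambda>x. -1 * pb (D i) (H' j) x)"
    by (rule ideal_eq_cong[OF scale_mem[OF pb_mem[OF D_mem H'_mem]], THEN ideal_eq_sym])
      (simp add: pb_antisym[OF H'_mem D_mem])
  also have "\<dots> \<sim> (\<lambda>x. -1 * (if i = j then 1 else 0))"
    by (intro ideal_eq_mult ideal_eq_refl const_mem pb_D_H')
  finally show ?thesis by simp
qed

lemma pb_H'_const_eq: "f \<sim> (\<lambda>x. c) \<Longrightarrow> pb (H' j) f \<in> \<I>"
  using pb_H'_eq[of f "\<lambda>x. c" j] ideal_cong[of "\<lambda>x. pb (H' j) f x - pb (H' j) (\<lambda>x. c) x" "pb (H' j) f"]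
  by (simp add: ideal_eq_def der_const[OF pb_der[OF H'_mem]])

text \<open>By the Jacobi identity only brackets of \<open>H'\<close> with {\<open>D k\<close>,
  \<open>H' i\<close>} and {\<open>D k\<close>, \<open>H' j\<close>} occur, and these two are
  constants modulo the ideal. This is the condition under which \<open>pb_ideal_second_order\<close>
  applies to {\<open>H' i\<close>, \<open>H' j\<close>}.\<close>

lemma pb_D_pb_H'_H': "pb (D k) (pb (H' i) (H' j)) \<in> \<I>"
proof -
  have "(\<lambda>x. - pb (H' j) (pb (D k) (H' i)) x + pb (H' i) (pb (D k) (H' j)) x) \<in> \<I>"
    by (intro ideal_add ideal_minus pb_H'_const_eq[OF pb_D_H'])
  then show ?thesis
    by (rule ideal_cong)
      (simp add: pb_leibniz[OF D_mem H'_mem H'_mem] pb_antisym[OF pb_mem[OF D_mem H'_mem] H'_mem])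
qed

text \<open>The Abelianisation Theorem with weak equality sharpened to congruence modulo
  \<open>\<I>\<close>, so that it can be iterated. The commutator is the field of \<open>?w\<close>;
  that \<open>?w\<close> lies in \<open>\<I>\<close> does not by itself place {\<open>f\<close>,
  \<open>?w\<close>} there for arbitrary \<open>f\<close>.\<close>

lemma chi_commute:
  assumes "f \<in> F"
  shows "pb (H' i) (pb (H' j) f) \<sim> pb (H' j) (pb (H' i) f)"
proof -
  let ?w = "pb (H' i) (H' j)"
  have "pb f ?w \<in> \<I>"
    by (rule pb_ideal_second_order[OF assms pb_H'_ideal[OF H'_ideal] pb_D_pb_H'_H'])
  from ideal_minus[OF this]
  have "(\<lambda>x. pb (H' i) (pb (H' j) f) x - pb (H' j) (pb (H' i) f) x) \<in> \<I>"
    by (rule ideal_cong)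
      (simp add: pb_leibniz[OF H'_mem[of i] H'_mem[of j] assms] pb_antisym[OF pb_mem[OF H'_mem H'_mem] assms])
  then show ?thesis
    by (simp add: ideal_eq_def pb_mem H'_mem assms)
qed

abbreviation chi :: "'j list \<Rightarrow> ('p \<Rightarrow> real) \<Rightarrow> 'p \<Rightarrow> real" where
  "chi \<equiv> foldr (\<lambda>j. pb (H' j))"

lemma chi_mem: "f \<in> F \<Longrightarrow> chi w f \<in> F"
  by (induction w) (simp_all add: pb_mem H'_mem)

lemma chi_move: "f \<in> F \<Longrightarrow> chi w (pb (H' j) f) \<sim> pb (H' j) (chi w f)"
proof (induction w)
  case (Cons i w)
  have "pb (H' i) (chi w (pb (H' j) f)) \<sim> pb (H' i) (pb (H' j) (chi w f))"
    by (rule pb_H'_eq[OF Cons.IH[OF Cons.prems]])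
  also have "\<dots> \<sim> pb (H' j) (pb (H' i) (chi w f))"
    by (rule chi_commute[OF chi_mem[OF Cons.prems]])
  finally show ?case by simp
qed (simp add: ideal_eq_refl pb_mem H'_mem)

lemma chi_perm: "f \<in> F \<Longrightarrow> mset w = mset w' \<Longrightarrow> chi w f \<sim> chi w' f"
proof (induction w arbitrary: w')
  case Nil
  then show ?case by (simp add: ideal_eq_refl)
next
  case (Cons a w)
  then have "a \<in> set w'"
    by (metis list.set_intros(1) mset_eq_setD)
  then obtain ys zs where w': "w' = ys @ a # zs"
    by (meson split_list)
  have "pb (H' a) (chi w f) \<sim> pb (H' a) (chi (ys @ zs) f)"
    using Cons.prems w' by (intro pb_H'_eq Cons.IH) simp_all
  also have "\<dots> \<sim> chi ys (pb (H' a) (chi zs f))"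
    using ideal_eq_sym[OF chi_move[OF chi_mem[OF Cons.prems(1)], of ys a zs]] by simp
  finally show ?case by (simp add: w')
qed

text \<open>One factor {\<open>H' j\<close>, .} is moved to the innermost place, so that lowering
  \<open>k j\<close> produces a term belonging to the function {\<open>H' j\<close>,
  \<open>f\<close>}.\<close>

lemma chi_word_pred:
  assumes "f \<in> F" "k \<in> multi_indices" "k j \<noteq> 0"
  shows "chi (word k) f \<sim> chi (word (k(j := k j - 1))) (pb (H' j) f)"
proof -
  have "mset (word k) = mset (j # word (k(j := k j - 1)))"
    using assms(2,3) by (intro multiset_eqI) (auto simp: count_word)
  then have "chi (word k) f \<sim> pb (H' j) (chi (word (k(j := k j - 1))) f)"
    using chi_perm[OF assms(1), of "word k" "j # word (k(j := k j - 1))"] by simp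
  also have "\<dots> \<sim> chi (word (k(j := k j - 1))) (pb (H' j) f)"
    by (rule ideal_eq_sym[OF chi_move[OF assms(1)]])
  finally show ?thesis .
qed

section \<open>Invariance of projected functions modulo the ideal\<close>

lemma divided_power_mem: "(\<lambda>x. D i x ^ n / fact n) \<in> F"
  by (intro divide_mem power_mem D_mem)

lemma monomial_mem: "monomial D k \<in> F"
  unfolding monomial_def[abs_def] by (intro prod_mem divided_power_mem)

lemma pb_H'_divided_power:
  "pb (H' j) (\<lambda>x. D i x ^ Suc n / fact (Suc n)) \<sim> (\<lambda>x. D i x ^ n / fact n * - (if i = j then 1 else 0))"
proof -
  have "pb (H' j) (\<lambda>x. D i x ^ Suc n / fact (Suc n)) \<sim> (\<lambda>x. D i x ^ n / fact n * pb (H' j) (D i) x)"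
    by (rule ideal_eq_sym, rule ideal_eq_cong[OF mult_mem[OF divided_power_mem pb_mem[OF H'_mem D_mem]]])
      (rule der_divided_power[OF pb_der[OF H'_mem] D_mem])
  also have "\<dots> \<sim> (\<lambda>x. D i x ^ n / fact n * - (if i = j then 1 else 0))"
    by (intro ideal_eq_mult ideal_eq_refl divided_power_mem pb_H'_D)
  finally show ?thesis .
qed

text \<open>Modulo the ideal {\<open>H' j\<close>, .} acts on the \<open>D i\<close> as minus the
  partial derivative with respect to \<open>D j\<close>. The factorials absorb the exponent, so
  exactly one lowered monomial remains.\<close>

lemma pb_H'_monomial:
  assumes "k \<in> multi_indices"
  shows "pb (H' j) (monomial D k) \<sim>
    (\<lambda>x. if k j = 0 then 0 else - monomial D (k(j := k j - 1)) x)"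
proof -
  define R where "R x = (\<Prod>i\<in>{i. k i \<noteq> 0} - {j}. D i x ^ k i / fact (k i))" for x
  have update: "monomial D (k(j := n)) x = D j x ^ n / fact n * R x" for n x
    unfolding R_def by (rule monomial_update[OF assms])
  have R_mem: "R \<in> F"
    unfolding R_def[abs_def] by (intro prod_mem divided_power_mem)
  have R_ideal: "pb (H' j) R \<in> \<I>"
    unfolding R_def[abs_def]
  proof (rule der_prod_ideal[OF _ pb_der[OF H'_mem] divided_power_mem])
    show "finite ({i. k i \<noteq> 0} - {j})"
      using assms by (simp add: multi_indices_def)
    fix i assume i: "i \<in> {i. k i \<noteq> 0} - {j}"
    then obtain n where "k i = Suc n"
      by (cases "k i") auto
    with i show "pb (H' j) (\<lambda>x. D i x ^ k i / fact (k i)) \<in> \<I>"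
      using pb_H'_divided_power[of j i n] by (intro ideal_eq_zeroD) (simp del: power_Suc fact_Suc)
  qed
  show ?thesis
  proof (cases "k j")
    case 0
    then have "monomial D k = R"
      using update[of 0] by (simp add: fun_eq_iff fun_upd_idem)
    then show ?thesis
      using 0 ideal_eq_zeroI[OF R_ideal] by simp
  next
    case (Suc n)
    let ?d = "\<lambda>x. D j x ^ Suc n / fact (Suc n)"
    have monomial: "monomial D k = (\<lambda>x. ?d x * R x)"
      using update[of "Suc n"] Suc by (simp add: fun_eq_iff fun_upd_idem)
    have "pb (H' j) (monomial D k) \<sim> (\<lambda>x. pb (H' j) ?d x * R x + ?d x * pb (H' j) R x)"
      unfolding monomial
      by (rule ideal_eq_sym, rule ideal_eq_cong)
        (intro add_mem mult_mem pb_mem H'_mem divided_power_mem R_mem,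
          rule der_mult[OF pb_der[OF H'_mem] divided_power_mem R_mem])
    also have "\<dots> \<sim> (\<lambda>x. (D j x ^ n / fact n * - (if j = j then 1 else 0)) * R x + ?d x * 0)"
      by (intro ideal_eq_add ideal_eq_mult pb_H'_divided_power ideal_eq_refl R_mem divided_power_mem
          ideal_eq_zeroI R_ideal)
    finally show ?thesis
      using Suc by (simp add: update)
  qed
qed

abbreviation P_term where "P_term f k \<equiv> projector_term pb D H' f k"

text \<open>By the product rule the field hits either the iterated brackets, which gives the term of
  {\<open>H' j\<close>, \<open>f\<close>} at \<open>k\<close>, or the monomial, which gives minus
  the term at the lowered index. Both belong to the same function, and this makes the series
  telescope.\<close>

lemma pb_H'_P_term:
  assumes "f \<in> F" "k \<in> multi_indices"
  shows "pb (H' j) (P_term f k) \<sim>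
    (\<lambda>x. P_term (pb (H' j) f) k x
      - (if k j = 0 then 0 else P_term (pb (H' j) f) (k(j := k j - 1)) x))"
proof -
  let ?m = "monomial D k" and ?X = "chi (word k) f"
  let ?m' = "monomial D (k(j := k j - 1))" and ?X' = "chi (word (k(j := k j - 1))) (pb (H' j) f)"
  note mem = monomial_mem[of k] chi_mem[OF assms(1), of "word k"]
  have "pb (H' j) (P_term f k) \<sim> (\<lambda>x. pb (H' j) ?m x * ?X x + ?m x * pb (H' j) ?X x)"
    unfolding projector_term_monomial
    by (rule ideal_eq_sym, rule ideal_eq_cong)
      (intro add_mem mult_mem pb_mem H'_mem mem, rule der_mult[OF pb_der[OF H'_mem] mem])
  also have "\<dots> \<sim> (\<lambda>x. (if k j = 0 then 0 else - ?m' x) * ?X x + ?m x * chi (word k) (pb (H' j) f) x)"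
    by (intro ideal_eq_add ideal_eq_mult pb_H'_monomial assms ideal_eq_refl mem
        ideal_eq_sym[OF chi_move[OF assms(1)]])
  also have "\<dots> \<sim> (\<lambda>x. (if k j = 0 then 0 else - ?m' x * ?X' x) + ?m x * chi (word k) (pb (H' j) f) x)"
  proof (cases "k j = 0")
    case True
    then show ?thesis
      using mult_mem[OF mem(1) chi_mem[OF pb_mem[OF H'_mem assms(1)]]] by (simp add: ideal_eq_refl)
  next
    case False
    have "(\<lambda>x. - ?m' x * ?X x + ?m x * chi (word k) (pb (H' j) f) x)
      \<sim> (\<lambda>x. - ?m' x * ?X' x + ?m x * chi (word k) (pb (H' j) f) x)"
      by (intro ideal_eq_add ideal_eq_mult ideal_eq_refl minus_mem monomial_mem mult_mem chi_mem
          pb_mem H'_mem chi_word_pred assms False)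
    with False show ?thesis by simp
  qed
  also have "\<dots> = (\<lambda>x. ?m x * chi (word k) (pb (H' j) f) x - (if k j = 0 then 0 else ?m' x * ?X' x))"
    by auto
  finally show ?thesis
    by (simp only: projector_term_monomial)
qed

text \<open>
  The terms of \<open>{H'\<^sub>j, P f}\<close> telescope; both shifted sums exist because \<open>P\<close> is also defined on
  \<open>{H'\<^sub>j, f}\<close>.
\<close>

lemma pb_H'_P:
  assumes "f \<in> F"
  shows "pb (H' j) (P f) \<in> \<I>"
proof -
  let ?g = "pb (H' j) f"
  let ?A = "\<lambda>k. P_term ?g k" and ?B = "\<lambda>k x. if k j = 0 then 0 else P_term ?g (k(j := k j - 1)) x"
  have g: "?g \<in> F"
    by (rule pb_mem[OF H'_mem assms])
  have A: "tsum multi_indices ?A (P ?g)"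
    by (rule P_sum[OF g])
  let ?\<phi> = "\<lambda>k :: 'j \<Rightarrow> nat. k(j := Suc (k j))"
  have inj: "inj_on ?\<phi> multi_indices"
  proof (rule inj_onI)
    fix k l assume eq: "?\<phi> k = ?\<phi> l"
    show "k = l"
    proof
      show "k i = l i" for i
        using fun_cong[OF eq, of i] by (cases "i = j") auto
    qed
  qed
  \<comment> \<open>Raising \<open>k j\<close> by one turns \<open>?B\<close> into
    \<open>?A\<close>. The multi-indices missed by the shift have \<open>k j = 0\<close>, where
    \<open>?B\<close> is zero by its definition, so extending the sum to all of them keeps its
    value.\<close>
  have "tsum (?\<phi> ` multi_indices) ?B (P ?g)"
    by (rule tsum_reindex[OF inj A]) simp
  then have B: "tsum multi_indices ?B (P ?g)"
  proof (rule tsum_extend)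
    fix k x assume k: "k \<in> multi_indices - ?\<phi> ` multi_indices"
    have "k j = 0"
    proof (rule ccontr)
      assume "k j \<noteq> 0"
      then have "k = ?\<phi> (k(j := k j - 1))" by simp
      then show False
        using k multi_indices_update[of k j "k j - 1"] by blast
    qed
    then show "?B k x = 0" by simp
  qed auto
  \<comment> \<open>The zero is kept as a difference of two sums because ideal membership is checked
    on the termwise difference of the three families.\<close>
  have "(\<lambda>x. pb (H' j) (P f) x - (P ?g x - P ?g x)) \<in> \<I>"
  proof (rule ideal_sum_multi_index[OF tsum_diff[OF tsum_der[OF P_sum[OF assms] pb_der[OF H'_mem]]
          tsum_diff[OF A B]]])
    fix k :: "'j \<Rightarrow> nat" assume "k \<in> multi_indices"
    then show "(\<lambda>x. pb (H' j) (P_term f k) x - (?A k x - ?B k x)) \<in> \<I>"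
      using pb_H'_P_term[OF assms] by (simp add: ideal_eq_def)
  qed
  then show ?thesis by simp
qed

section \<open>The inverse matrix \<open>E\<close> on the constraint surface\<close>

lemma pb_weak:
  assumes "x \<in> S"
  shows "pb (H i) (H' j) x = 0" "pb (H' i) (H j) x = 0" "pb (H' i) (H' j) x = 0"
    "pb (D i) (H' j) x = (if i = j then 1 else 0)"
    "pb (H' j) (D i) x = - (if i = j then 1 else 0)"
  using assms ideal_vanish[OF pb_H_ideal[OF H'_ideal]] ideal_vanish[OF pb_H'_ideal[OF H'_ideal]]
    ideal_vanish[OF pb_H'_ideal[OF constraint_ideal.gen]] ideal_eq_weak[OF pb_D_H']
    ideal_eq_weak[OF pb_H'_D]
  by simp_all

text \<open>On \<open>S\<close> the function \<open>DB f (H' j)\<close> vanishes, since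
  \<open>H' j\<close> is in the ideal, and {\<open>C b\<close>, \<open>H' j\<close>} is 1 for
  \<open>b = Inl j\<close> and 0 otherwise, so the sum over \<open>b\<close> collapses. The columns
  of \<open>E\<close> belonging to \<open>D\<close> are thus reached without multiplying infinite
  matrices.\<close>

lemma has_sum_pb_H':
  assumes "f \<in> F" "x \<in> S"
  shows "((\<lambda>a. pb f (C a) x * E a (Inl j) x) has_sum pb f (H' j) x) UNIV"
proof -
  have pb_C: "pb (C b) (H' j) x = (if b = Inl j then 1 else 0)" for b
    using pb_weak[OF assms(2)] by (cases b) simp_all
  have "((\<lambda>b. dirac_term pb C E f (H' j) (a, b) x) has_sum
      dirac_term pb C E f (H' j) (a, Inl j) x) UNIV" for a
    by (rule has_sum_single_index) (simp_all add: dirac_term_apply pb_C)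
  then have inner: "((\<lambda>b. dirac_term pb C E f (H' j) (a, b) x) has_sum
      pb f (C a) x * E a (Inl j) x) UNIV" for a
    using pb_C[of "Inl j"] by (simp add: dirac_term_apply)
  have "((\<lambda>a. pb f (C a) x * E a (Inl j) x) has_sum (pb f (H' j) x - DB f (H' j) x)) UNIV"
    by (rule has_sum_pair_left[OF has_sum_dirac[OF assms(1) H'_mem] inner]) (use assms(2) in simp)
  then show ?thesis
    using ideal_vanish[OF DB_ideal[OF assms(1) H'_ideal] assms(2)] by simp
qed

text \<open>For \<open>f = H' i\<close> in \<open>has_sum_pb_H'\<close> the left side reduces to
  minus this entry and the right side is {\<open>H' i\<close>, \<open>H' j\<close>}, which is zero
  on \<open>S\<close>. For finite matrices it is the block formula for an inverse when the block
  {\<open>H\<close>, \<open>H\<close>} vanishes.\<close>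

lemma E_Inl_Inl:
  assumes "x \<in> S"
  shows "E (Inl i) (Inl j) x = 0"
proof -
  have pb_C: "pb (H' i) (C a) x = - (if a = Inl i then 1 else 0)" for a
    using pb_weak[OF assms] by (cases a) simp_all
  have "((\<lambda>a. pb (H' i) (C a) x * E a (Inl j) x) has_sum
      pb (H' i) (C (Inl i)) x * E (Inl i) (Inl j) x) UNIV"
    by (rule has_sum_single_index) (simp_all add: pb_C)
  then have "pb (H' i) (C (Inl i)) x * E (Inl i) (Inl j) x = pb (H' i) (H' j) x"
    using has_sum_pb_H'[OF H'_mem assms] by (rule has_sum_unique)
  then show ?thesis
    using pb_weak[OF assms] by simp
qed

text \<open>A correction term with an index from \<open>H\<close> contains a bracket of an
  observable with a constraint; the remaining ones carry an entry of \<open>E\<close> that vanishes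
  by \<open>E_Inl_Inl\<close>.\<close>

lemma DB_Obs:
  assumes "f \<in> Obs" "g \<in> Obs" "x \<in> S"
  shows "DB f g x = pb f g x"
proof -
  have zero: "pb f (H i) x = 0" "pb (H i) g x = 0" for i
    using assms pb_observable_ideal[OF assms(1) constraint_ideal.gen assms(3)]
    by (simp_all add: Obs_iff)
  have "dirac_term pb C E f g (a, b) x = 0" for a b
    by (cases a; cases b) (simp_all add: dirac_term_apply zero E_Inl_Inl[OF assms(3)])
  then have "dirac_term pb C E f g ab x = 0" for ab
    by (cases ab) simp
  then show ?thesis
    by (simp add: dirac_bracket_def)
qed

text \<open>
  On the constraint surface the identity \<open>DB f H\<^sub>k = 0\<close> reads \<open>{f, H\<^sub>k} = \<Sum>\<^sub>j {f, H'\<^sub>j} M\<^sub>j\<^sub>k\<close>.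
\<close>

lemma Obs_if_pb_H':
  assumes "f \<in> F" "\<And>x j. x \<in> S \<Longrightarrow> pb (H' j) f x = 0"
  shows "f \<in> Obs"
  unfolding Obs_iff
proof (intro conjI ballI allI assms(1))
  fix x i assume x: "x \<in> S"
  have "pb f (H' j) x = 0" for j
    using assms(2)[OF x, of j] pb_antisym[OF assms(1) H'_mem, of x j] x by simp
  then have zero: "((\<lambda>a. pb f (C a) x * E a (Inl j) x) has_sum 0) UNIV" for j
    using has_sum_pb_H'[OF assms(1) x, of j] by simp
  \<comment> \<open>Summing over \<open>a\<close> first, an index \<open>b\<close> from
    \<open>D\<close> yields a multiple of {\<open>f\<close>, \<open>H' j\<close>}, which is zero by
    assumption; for \<open>b\<close> from \<open>H\<close> the factor {\<open>H j\<close>,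
    \<open>H i\<close>} vanishes on \<open>S\<close>.\<close>
  have inner: "((\<lambda>a. dirac_term pb C E f (H i) (a, b) x) has_sum 0) UNIV" for b
  proof (cases b)
    case (Inl j)
    then show ?thesis
      using has_sum_cmult_left[OF zero[of j], of "pb (D j) (H i) x"] by (simp add: dirac_term_apply)
  next
    case (Inr j)
    then show ?thesis
      using ideal_vanish[OF pb_H_H x] by (simp add: dirac_term_apply)
  qed
  have "((\<lambda>b :: 'j + 'j. 0) has_sum (pb f (H i) x - DB f (H i) x)) UNIV"
    by (rule has_sum_pair_right[OF has_sum_dirac[OF assms(1) H_mem] inner]) (use x in simp)
  then have "pb f (H i) x - DB f (H i) x = 0"
    using has_sum_0_simp by (rule has_sum_unique)
  then show "pb (H i) f x = 0"
    using DB_C[OF assms(1), of x "Inr i"] pb_antisym[OF assms(1) H_mem, of x i] x by simp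
qed

lemma P_mem: "f \<in> F \<Longrightarrow> P f \<in> F"
  by (rule tsum_mem[OF P_sum])

lemma P_Obs: "f \<in> F \<Longrightarrow> P f \<in> Obs"
  by (intro Obs_if_pb_H' P_mem ideal_vanish[OF pb_H'_P])

text \<open>The Leibniz form of Jacobi leaves brackets of an observable with {\<open>H' j\<close>,
  \<open>P f\<close>} or {\<open>H' j\<close>, \<open>P g\<close>}. That these two lie in the ideal
  is essential: weak vanishing need not survive another bracket.\<close>

lemma pb_P_Obs:
  assumes "f \<in> F" "g \<in> F"
  shows "pb (P f) (P g) \<in> Obs"
proof (rule Obs_if_pb_H'[OF pb_mem[OF P_mem[OF assms(1)] P_mem[OF assms(2)]]])
  fix x j assume x: "x \<in> S"
  have "pb (P g) (pb (H' j) (P f)) x = 0" "pb (P f) (pb (H' j) (P g)) x = 0"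
    by (rule pb_observable_ideal[OF P_Obs pb_H'_P x]; rule assms)+
  then show "pb (H' j) (pb (P f) (P g)) x = 0"
    using x pb_leibniz[OF H'_mem P_mem[OF assms(1)] P_mem[OF assms(2)], of x j]
      pb_antisym[OF pb_mem[OF H'_mem P_mem[OF assms(1)]] P_mem[OF assms(2)], of x j] by simp
qed

lemma mult_Obs:
  assumes "f \<in> Obs" "g \<in> Obs"
  shows "(\<lambda>x. f x * g x) \<in> Obs"
  using assms unfolding Obs_iff by (simp add: mult_mem der_mult[OF pb_der[OF H_mem]])

text \<open>The curve is handled through its exponential series alone. It stays on \<open>S\<close>
  because all iterated brackets of \<open>h\<close> with \<open>H i\<close> lie in the ideal and
  hence vanish at \<open>x\<close>; constancy of observables then follows by comparing
  coefficients.\<close>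

lemma Obs_along_flow:
  assumes "x \<in> S"
  shows "\<exists>y\<in>S \<inter> zero_set D. \<forall>f\<in>Obs. f y = f x"
proof -
  obtain \<beta> h \<gamma> where h: "tsum UNIV (\<lambda>j z. \<beta> j * H' j z) h"
    and \<gamma>: "\<And>t. t \<in> {0..1} \<Longrightarrow> \<gamma> t \<in> U" "\<gamma> 1 \<in> zero_set D"
    and series: "\<And>f t. f \<in> F \<Longrightarrow> t \<in> {0..1} \<Longrightarrow>
      (\<lambda>n. t ^ n / fact n * (pb h ^^ n) f x) sums f (\<gamma> t)"
    using flow[OF assms] by blast
  have h_ideal: "h \<in> \<I>"
    by (rule ideal_sum_index[OF h]) (rule ideal_scale[OF H'_ideal])
  note h_mem = ideal_mem[OF h_ideal]
  have \<gamma>_S: "\<gamma> t \<in> S" if t: "t \<in> {0..1}" for t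
  proof -
    have "H i (\<gamma> t) = 0" for i
    proof -
      have "(pb h ^^ n) (H i) \<in> \<I>" for n
        by (induction n) (simp_all add: constraint_ideal.gen pb_ideal_ideal[OF h_ideal])
      then have "(pb h ^^ n) (H i) x = 0" for n
        using assms by (rule ideal_vanish)
      then show ?thesis
        using series[OF H_mem t, of i] sums_unique2[OF _ sums_zero] by simp
    qed
    then show ?thesis
      using \<gamma>(1)[OF t] by (simp add: zero_set_def)
  qed
  have "f (\<gamma> 1) = f x" if f: "f \<in> Obs" for f
  proof -
    have f_mem: "f \<in> F"
      using f by (simp add: Obs_iff)
    have flow_zero: "pb h f (\<gamma> t) = 0" if "t \<in> {0..1}" for t
      using pb_observable_ideal[OF f h_ideal \<gamma>_S[OF that]] \<gamma>(1)[OF that]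
        pb_antisym[OF h_mem f_mem, of "\<gamma> t"] by simp
    \<comment> \<open>For an observable, {\<open>h\<close>, \<open>f\<close>} is known to vanish on
      \<open>S\<close> but not to lie in the ideal, so its iterated brackets at \<open>x\<close>
      cannot be read off algebraically. They are the coefficients of a series that vanishes for all
      these \<open>t\<close>.\<close>
    have "(\<lambda>n. t ^ n * ((pb h ^^ n) (pb h f) x / fact n)) sums 0" if "0 < t" "t \<le> 1" for t :: real
      using series[OF pb_mem[OF h_mem f_mem], of t] flow_zero[of t] that by simp
    then have "(pb h ^^ n) (pb h f) x / fact n = 0" for n
      by (rule power_series_zero_coeff)
    then have "(pb h ^^ Suc n) f x = 0" for n
      by (simp add: funpow_swap1)
    then have "1 ^ n / fact n * (pb h ^^ n) f x = (if n = 0 then f x else 0)" for n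
      by (cases n) (simp_all del: funpow.simps(2))
    then have "(\<lambda>n. if n = 0 then f x else 0) sums f (\<gamma> 1)"
      using series[OF f_mem, of 1] by simp
    then show ?thesis
      using sums_unique2[OF _ sums_single[of 0 "\<lambda>_. f x"]] by simp
  qed
  then show ?thesis
    using \<gamma>(2) \<gamma>_S[of 1] by (intro bexI[of _ "\<gamma> 1"]) auto
qed

lemma Obs_eqI:
  assumes "f \<in> Obs" "g \<in> Obs" "\<And>y. y \<in> S \<inter> zero_set D \<Longrightarrow> f y = g y" "x \<in> S"
  shows "f x = g x"
  using Obs_along_flow[OF assms(4)] assms(1-3) by metis

section \<open>The projector where the gauge conditions vanish\<close>

lemma monomial_zero:
  assumes "k \<in> multi_indices" "k \<noteq> (\<lambda>j. 0)" "x \<in> zero_set D"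
  shows "monomial D k x = 0"
proof -
  obtain j where "k j \<noteq> 0"
    using assms(2) by auto
  then show ?thesis
    using assms(1,3) unfolding monomial_def
    by (intro prod_zero) (auto simp: multi_indices_def zero_set_def)
qed

lemma P_term_zero: "P_term f (\<lambda>j. 0) = f"
  by (simp add: projector_term_monomial monomial_def word_def)

lemma zero_multi_index: "(\<lambda>j. 0) \<in> multi_indices"
  by (simp add: multi_indices_def)

lemma P_gauge:
  assumes "f \<in> F" "x \<in> U" "x \<in> zero_set D"
  shows "P f x = f x"
proof -
  have "((\<lambda>k. P_term f k x) has_sum P_term f (\<lambda>j. 0) x) multi_indices"
    by (rule has_sum_single_index[OF _ zero_multi_index])
      (simp add: projector_term_monomial monomial_zero assms(3))
  then show ?thesis
    using has_sum_unique[OF tsum_has_sum[OF P_sum[OF assms(1)] assms(2)]] by (simp add: P_term_zero)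
qed

text \<open>Every term with \<open>k\<close> nonzero has a monomial in the \<open>D i\<close> as
  factor. The monomial is zero at \<open>x\<close>, and so is its image under
  \<open>\<delta>\<close>, so neither part of the product rule contributes.\<close>

lemma der_P_gauge:
  assumes "f \<in> F" "x \<in> U" "x \<in> zero_set D" "der \<delta>" "\<And>i. \<delta> (D i) x = 0"
  shows "\<delta> (P f) x = \<delta> f x"
proof -
  have "\<delta> (P_term f k) x = 0" if k: "k \<in> multi_indices" "k \<noteq> (\<lambda>j. 0)" for k
  proof -
    have "\<delta> (monomial D k) x = 0"
      unfolding monomial_def[abs_def]
    proof (rule der_prod[OF _ assms(4) divided_power_mem _ assms(2)])
      show "finite {i. k i \<noteq> 0}"
        using k by (simp add: multi_indices_def)
      fix i assume "i \<in> {i. k i \<noteq> 0}"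
      then obtain n where "k i = Suc n"
        by (cases "k i") auto
      then show "\<delta> (\<lambda>x. D i x ^ k i / fact (k i)) x = 0"
        using der_divided_power[OF assms(4) D_mem assms(2), of i n] assms(5) by simp
    qed
    then show ?thesis
      unfolding projector_term_monomial
      using der_mult[OF assms(4) monomial_mem chi_mem[OF assms(1)] assms(2)]
      by (simp add: monomial_zero[OF k assms(3)])
  qed
  then have "((\<lambda>k. \<delta> (P_term f k) x) has_sum \<delta> (P_term f (\<lambda>j. 0)) x) multi_indices"
    by (intro has_sum_single_index[OF _ zero_multi_index])
  then show ?thesis
    using has_sum_unique[OF tsum_has_sum[OF tsum_der[OF P_sum[OF assms(1)] assms(4)] assms(2)]]
    by (simp add: P_term_zero)
qed

text \<open>Both sides are observables, so common zeros decide. There the Poisson bracket is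
  replaced by the Dirac bracket, and the projector is removed from one slot at a time, each slot
  being a derivation that annihilates the \<open>D i\<close>.\<close>

lemma P_bracket:
  assumes "f \<in> F" "g \<in> F" "x \<in> S"
  shows "pb (P f) (P g) x = P (DB f g) x"
proof (rule Obs_eqI[OF pb_P_Obs[OF assms(1,2)] P_Obs[OF DB_mem[OF assms(1,2)]] _ assms(3)])
  fix y assume y: "y \<in> S \<inter> zero_set D"
  have "pb (P f) (P g) y = DB (P f) (P g) y"
    using DB_Obs[OF P_Obs[OF assms(1)] P_Obs[OF assms(2)]] y by simp
  also have "\<dots> = DB (P f) g y"
    using y DB_C[OF P_mem[OF assms(1)], of y "Inl _"]
    by (intro der_P_gauge[OF assms(2) _ _ DB_der[OF P_mem[OF assms(1)]]]) auto
  also have "\<dots> = DB f g y"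
    using y DB_C_left[OF assms(2), of y "Inl _"]
    by (intro der_P_gauge[OF assms(1) _ _ DB_der_left[OF assms(2)]]) auto
  also have "\<dots> = P (DB f g) y"
    using y P_gauge[OF DB_mem[OF assms(1,2)]] by simp
  finally show "pb (P f) (P g) y = P (DB f g) y" .
qed

lemma P_mult:
  assumes "f \<in> F" "g \<in> F" "x \<in> S"
  shows "P f x * P g x = P (\<lambda>x. f x * g x) x"
  by (rule Obs_eqI[OF mult_Obs[OF P_Obs P_Obs] P_Obs[OF mult_mem] _ assms(3)])
    (use assms(1,2) in \<open>simp_all add: P_gauge mult_mem\<close>)

lemma P_add:
  assumes "f \<in> F" "g \<in> F" "x \<in> U"
  shows "P f x + P g x = P (\<lambda>x. f x + g x) x"
proof -
  have iter: "chi w f = iter (map (\<lambda>j. pb (H' j)) w) f" for w f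
    by (induction w) simp_all
  have "chi w (\<lambda>x. f x + g x) x = chi w f x + chi w g x" for w
    unfolding iter by (rule iter_add) (use assms pb_der[OF H'_mem] in auto)
  then have "((\<lambda>k. P_term f k x + P_term g k x) has_sum P (\<lambda>x. f x + g x) x) multi_indices"
    using tsum_has_sum[OF P_sum[OF add_mem[OF assms(1,2)]] assms(3)]
    by (simp add: projector_term_monomial algebra_simps)
  moreover have "((\<lambda>k. P_term f k x + P_term g k x) has_sum P f x + P g x) multi_indices"
    by (intro has_sum_add tsum_has_sum[OF P_sum] assms)
  ultimately show ?thesis
    using has_sum_unique by blast
qed

text \<open>Surjectivity, both inverse relations and the annihilation property are instances, the
  first three with an observable as \<open>g\<close> and the last with \<open>g\<close>
  zero.\<close>

lemma P_determined:
  assumes "f \<in> F" "g \<in> Obs" "\<And>y. y \<in> S \<inter> zero_set D \<Longrightarrow> f y = g y" "x \<in> S"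
  shows "P f x = g x"
  by (rule Obs_eqI[OF P_Obs[OF assms(1)] assms(2) _ assms(4)]) (simp add: P_gauge assms(1,3))

text \<open>
  Replacing \<open>(D, H)\<close> by \<open>(- H, D)\<close> transposes \<open>M\<close> and turns \<open>P\<close> into the opposite projector \<open>Q\<close>.
\<close>

definition swapped_sign :: "'j + 'j \<Rightarrow> real" where
  "swapped_sign = case_sum (\<lambda>_. -1) (\<lambda>_. 1)"

abbreviation swap where "swap \<equiv> case_sum Inr Inl"

text \<open>The exchange conjugates the bracket matrix by a signed permutation, and its inverse is
  conjugated in the same way because the signs square to 1.\<close>

definition swapped_E :: "'j + 'j \<Rightarrow> 'j + 'j \<Rightarrow> 'p \<Rightarrow> real" where
  "swapped_E a b = (\<lambda>x. swapped_sign a * swapped_sign b * E (swap a) (swap b) x)"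

abbreviation swapped_C where "swapped_C \<equiv> combined (\<lambda>j x. - H j x) D"

lemma swap_swap [simp]: "swap (swap a) = a"
  by (cases a) simp_all

lemma swapped_sign_square [simp]: "swapped_sign a * swapped_sign a = 1"
  by (cases a) (simp_all add: swapped_sign_def)

lemma swapped_C: "swapped_C a = (\<lambda>x. swapped_sign a * C (swap a) x)"
  by (cases a) (simp_all add: combined_def swapped_sign_def)

lemma pb_swapped_C_left:
  "f \<in> F \<Longrightarrow> x \<in> U \<Longrightarrow> pb (swapped_C a) f x = swapped_sign a * pb (C (swap a)) f x"
  unfolding swapped_C by (rule der_scale[OF pb_der_left C_mem])

lemma pb_swapped_C_right:
  "f \<in> F \<Longrightarrow> x \<in> U \<Longrightarrow> pb f (swapped_C a) x = swapped_sign a * pb f (C (swap a)) x"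
  unfolding swapped_C by (rule der_scale[OF pb_der C_mem])

lemma swapped_C_mem: "swapped_C a \<in> F"
  unfolding swapped_C by (rule scale_mem[OF C_mem])

lemma swapped_E_inverse:
  "matrix_inverse F U (\<lambda>a b. pb (swapped_C a) (swapped_C b)) swapped_E"
proof -
  have inj: "inj swap"
    by (rule inj_on_inverseI[of _ swap]) simp
  have surj: "range swap = UNIV"
    by (rule surjI[of swap swap]) simp
  have pb_C: "pb (swapped_C a) (swapped_C b) x
      = swapped_sign a * swapped_sign b * pb (C (swap a)) (C (swap b)) x" if "x \<in> U" for a b x
    using that by (simp add: pb_swapped_C_left swapped_C_mem pb_swapped_C_right C_mem)
  have reindex: "tsum UNIV (\<lambda>b x. swapped_sign a * swapped_sign c * g (swap b) x)
      (\<lambda>x. if a = c then 1 else 0)"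
    if "tsum UNIV g (\<lambda>x. if swap a = swap c then 1 else 0)" for a c and g :: "'j + 'j \<Rightarrow> 'p \<Rightarrow> real"
  proof -
    have "tsum (range swap) (\<lambda>b. g (swap b)) (\<lambda>x. if swap a = swap c then 1 else 0)"
      by (rule tsum_reindex[OF inj that]) simp
    from tsum_mult[OF const_mem[of "swapped_sign a * swapped_sign c"] this] show ?thesis
      unfolding surj by (rule tsum_cong) (auto dest: injD[OF inj])
  qed
  show ?thesis
    unfolding matrix_inverse_def
  proof (intro conjI allI)
    show "swapped_E a b \<in> F" for a b
      unfolding swapped_E_def by (rule scale_mem[OF E_mem])
    show "tsum UNIV (\<lambda>b x. pb (swapped_C a) (swapped_C b) x * swapped_E b c x)
        (\<lambda>x. if a = c then 1 else 0)" for a c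
      by (rule tsum_cong[OF reindex[OF E_right]])
        (simp_all add: pb_C swapped_E_def mult_ac)
    show "tsum UNIV (\<lambda>b x. swapped_E a b x * pb (swapped_C b) (swapped_C c) x)
        (\<lambda>x. if a = c then 1 else 0)" for a c
      by (rule tsum_cong[OF reindex[OF E_left]]) (simp_all add: pb_C swapped_E_def mult_ac)
  qed
qed

text \<open>Each index contributes its sign twice, from the constraint and from
  \<open>swapped_E\<close>. The signs cancel, so the exchange is a mere reindexing and both pairs
  have the same Dirac bracket.\<close>

lemma swapped_dirac_tsum:
  assumes "f \<in> F" "g \<in> F"
  shows "tsum UNIV (dirac_term pb swapped_C swapped_E f g)
    (\<lambda>x. \<Sum>\<^sub>\<infinity>ab. dirac_term pb C E f g ab x)"
proof -
  let ?\<phi> = "\<lambda>(a, b). (swap a, swap b)"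
  have inj: "inj ?\<phi>"
    by (rule inj_on_inverseI[of _ ?\<phi>]) auto
  have surj: "range ?\<phi> = UNIV"
    by (rule surjI[of ?\<phi> ?\<phi>]) auto
  have "tsum (range ?\<phi>) (\<lambda>ab. dirac_term pb C E f g (?\<phi> ab))
      (\<lambda>x. \<Sum>\<^sub>\<infinity>ab. dirac_term pb C E f g ab x)"
    by (rule tsum_reindex[OF inj dirac_sum[OF assms]]) auto
  then show ?thesis
    unfolding surj
  proof (rule tsum_cong)
    fix ab x assume "x \<in> U"
    then show "dirac_term pb swapped_C swapped_E f g ab x = dirac_term pb C E f g (?\<phi> ab) x"
      using swapped_sign_square[of "fst ab"] swapped_sign_square[of "snd ab"]
      by (cases ab) (simp add: dirac_term_def pb_swapped_C_left pb_swapped_C_right assms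
          swapped_E_def mult_ac)
  qed simp
qed

lemma swapped_dirac_infsum:
  assumes "f \<in> F" "g \<in> F" "x \<in> U"
  shows "(\<Sum>\<^sub>\<infinity>ab. dirac_term pb swapped_C swapped_E f g ab x) = (\<Sum>\<^sub>\<infinity>ab. dirac_term pb C E f g ab x)"
  by (rule infsumI[OF tsum_has_sum[OF swapped_dirac_tsum[OF assms(1,2)] assms(3)]])

lemma swapped_dirac_sum:
  assumes "f \<in> F" "g \<in> F"
  shows "tsum UNIV (dirac_term pb swapped_C swapped_E f g)
    (\<lambda>x. \<Sum>\<^sub>\<infinity>ab. dirac_term pb swapped_C swapped_E f g ab x)"
  by (rule tsum_cong[OF swapped_dirac_tsum[OF assms]]) (simp_all add: swapped_dirac_infsum assms)

lemma swapped_DB: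
  "f \<in> F \<Longrightarrow> g \<in> F \<Longrightarrow> x \<in> U \<Longrightarrow> dirac_bracket pb swapped_C swapped_E f g x = DB f g x"
  by (simp add: dirac_bracket_def swapped_dirac_infsum)

end

section \<open>The Poisson bracket of a symplectic Banach manifold\<close>

lemma smooth_on_differentiable: "smooth_on S f \<Longrightarrow> x \<in> S \<Longrightarrow> f differentiable (at x)"
  unfolding smooth_on_def using Ck_on.simps(2)[of 0 S f] by blast

locale symplectic_domain =
  fixes A :: "('p::t2_space, 'e::banach) chart set"
    and om :: "('p, 'e) chart \<Rightarrow> 'p \<Rightarrow> 'e \<Rightarrow> 'e \<Rightarrow> real" and U :: "'p set"
  assumes atlas: "banach_atlas A" and symplectic: "symplectic_form A om" and open_U: "open U"
begin

lemma chart_homeomorphism: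
  "c \<in> A \<Longrightarrow> homeomorphism (fst c) (snd c ` fst c) (snd c) (inv_into (fst c) (snd c))"
  using atlas by (simp add: banach_atlas_def)

lemma chart_at: "chart_at A x \<in> A" "x \<in> fst (chart_at A x)"
proof -
  have "x \<in> (\<Union>c\<in>A. fst c)"
    using atlas unfolding banach_atlas_def by blast
  then have "\<exists>c. c \<in> A \<and> x \<in> fst c"
    by blast
  from someI_ex[OF this] show "chart_at A x \<in> A" "x \<in> fst (chart_at A x)"
    by (simp_all add: chart_at_def)
qed

lemma open_chart_image:
  assumes "c \<in> A"
  shows "open (snd c ` (fst c \<inter> U))"
proof -
  have "openin (top_of_set (snd c ` fst c)) (snd c ` (fst c \<inter> U))"
    by (rule homeomorphism_imp_open_map[OF chart_homeomorphism[OF assms]])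
      (use open_U in \<open>simp add: openin_open_Int\<close>)
  moreover have "open (snd c ` fst c)"
    using atlas assms unfolding banach_atlas_def by blast
  ultimately show ?thesis
    by (rule openin_open_trans)
qed

lemma in_chart_apply: "c \<in> A \<Longrightarrow> x \<in> fst c \<Longrightarrow> in_chart c f (snd c x) = f x"
  using homeomorphism_apply1[OF chart_homeomorphism] by (simp add: in_chart_def)

abbreviation Ham where "Ham \<equiv> hamiltonian_functions A om U"

lemma has_derivative_in_chart:
  assumes "f \<in> Ham" "c \<in> A" "x \<in> fst c \<inter> U"
  shows "(in_chart c f has_derivative diff_in c f x) (at (snd c x))"
  unfolding diff_in_def frechet_derivative_works[symmetric]
  by (rule smooth_on_differentiable[of "snd c ` (fst c \<inter> U)"])
    (use assms in \<open>auto simp: hamiltonian_functions_def\<close>)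

lemma diff_in_eqI: "(in_chart c f has_derivative L) (at (snd c x)) \<Longrightarrow> diff_in c f x = L"
  unfolding diff_in_def by (rule frechet_derivative_at[symmetric])

lemma ham_vec:
  assumes "f \<in> Ham" "c \<in> A" "x \<in> fst c \<inter> U"
  shows "om c x (ham_vec om c f x) w = diff_in c f x w"
proof -
  have bilinear: "bounded_bilinear (om c x)" and nondegenerate: "\<And>v. (\<forall>w. om c x v w = 0) \<Longrightarrow> v = 0"
    using symplectic assms(2,3) unfolding symplectic_form_def by blast+
  obtain v where v: "is_ham_vec om c f x v"
    using assms by (auto simp: hamiltonian_functions_def)
  have "v' = v" if "is_ham_vec om c f x v'" for v'
    using nondegenerate[of "v' - v"] that v
    by (simp add: is_ham_vec_def bounded_bilinear.diff_left[OF bilinear])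
  with v have "is_ham_vec om c f x (ham_vec om c f x)"
    unfolding ham_vec_def by (rule theI)
  then show ?thesis
    by (simp add: is_ham_vec_def)
qed

text \<open>{\<open>f\<close>, \<open>g\<close>} is the form evaluated on the Hamiltonian vectors of
  \<open>g\<close> and \<open>f\<close>, in this order; skewness comes from the alternating property
  by polarisation.\<close>

lemma poisson_bracket_antisym:
  assumes "f \<in> Ham" "g \<in> Ham" "x \<in> U"
  shows "poisson_bracket A om f g x = - poisson_bracket A om g f x"
proof -
  let ?c = "chart_at A x"
  have x: "x \<in> fst ?c \<inter> U"
    using chart_at assms(3) by simp
  have bilinear: "bounded_bilinear (om ?c x)" and alternating: "\<And>v. om ?c x v v = 0"
    using symplectic chart_at[of x] unfolding symplectic_form_def by blast+
  have "om ?c x v w = - om ?c x w v" for v w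
    using alternating[of "v + w"] alternating[of v] alternating[of w]
    by (simp add: bounded_bilinear.add_left[OF bilinear] bounded_bilinear.add_right[OF bilinear])
  then show ?thesis
    unfolding poisson_bracket_def
    using ham_vec[OF assms(1) chart_at(1) x] ham_vec[OF assms(2) chart_at(1) x] by metis
qed

lemma diff_in_scale:
  assumes "f \<in> Ham" "c \<in> A" "x \<in> fst c \<inter> U"
  shows "diff_in c (\<lambda>y. a * f y) x v = a * diff_in c f x v"
proof -
  have "(in_chart c (\<lambda>y. a * f y) has_derivative (\<lambda>v. a * diff_in c f x v)) (at (snd c x))"
    using has_derivative_mult_right[OF has_derivative_in_chart[OF assms], of a]
    by (simp add: in_chart_def o_def)
  then show ?thesis
    by (simp add: diff_in_eqI)
qed

lemma diff_in_add:
  assumes "f \<in> Ham" "g \<in> Ham" "c \<in> A" "x \<in> fst c \<inter> U"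
  shows "diff_in c (\<lambda>y. f y + g y) x v = diff_in c f x v + diff_in c g x v"
proof -
  have "(in_chart c (\<lambda>y. f y + g y) has_derivative (\<lambda>v. diff_in c f x v + diff_in c g x v))
      (at (snd c x))"
    using has_derivative_add[OF has_derivative_in_chart[OF assms(1,3,4)]
        has_derivative_in_chart[OF assms(2,3,4)]]
    by (simp add: in_chart_def o_def)
  then show ?thesis
    by (simp add: diff_in_eqI)
qed

lemma diff_in_mult:
  assumes "f \<in> Ham" "g \<in> Ham" "c \<in> A" "x \<in> fst c \<inter> U"
  shows "diff_in c (\<lambda>y. f y * g y) x v = diff_in c f x v * g x + f x * diff_in c g x v"
proof -
  have "(in_chart c (\<lambda>y. f y * g y) has_derivative
      (\<lambda>v. in_chart c f (snd c x) * diff_in c g x v + diff_in c f x v * in_chart c g (snd c x)))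
      (at (snd c x))"
    using has_derivative_mult[OF has_derivative_in_chart[OF assms(1,3,4)]
        has_derivative_in_chart[OF assms(2,3,4)]]
    by (simp add: in_chart_def o_def)
  then show ?thesis
    using assms(3,4) by (simp add: diff_in_eqI in_chart_apply)
qed

lemma diff_in_cong:
  assumes "f \<in> Ham" "c \<in> A" "x \<in> fst c \<inter> U" "\<And>y. y \<in> U \<Longrightarrow> g y = f y"
  shows "diff_in c g x = diff_in c f x"
proof -
  have "(in_chart c g has_derivative diff_in c f x) (at (snd c x))"
  proof (rule has_derivative_transform_within_open[OF has_derivative_in_chart[OF assms(1-3)]
        open_chart_image[OF assms(2)]])
    show "snd c x \<in> snd c ` (fst c \<inter> U)"
      using assms(3) by blast
    show "in_chart c f z = in_chart c g z" if "z \<in> snd c ` (fst c \<inter> U)" for z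
      using that assms(2,4) by (auto simp: in_chart_apply)
  qed
  then show ?thesis
    by (rule diff_in_eqI)
qed

lemma poisson_functions:
  assumes "poisson_algebra A om U F"
  shows "poisson_functions F U (poisson_bracket A om)"
proof -
  let ?pb = "poisson_bracket A om"
  have Ham: "f \<in> Ham" if "f \<in> F" for f
    using assms that by (auto simp: poisson_algebra_def)
  have x: "x \<in> fst (chart_at A x) \<inter> U" if "x \<in> U" for x
    using that chart_at by simp
  interpret function_algebra F U
  proof
    show "g \<in> F" if "f \<in> F" "\<And>x. x \<in> U \<Longrightarrow> g x = f x" for f g
      using assms that unfolding poisson_algebra_def by blast
  qed (use assms in \<open>auto simp: poisson_algebra_def\<close>)
  show ?thesis
  proof
    fix f assume f: "f \<in> F"
    show "derivation_on F U (?pb f)"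
    proof (rule derI)
      show "?pb f g \<in> F" if "g \<in> F" for g
        using assms f that by (auto simp: poisson_algebra_def)
      show "?pb f g x = ?pb f h x" if "g \<in> F" "h \<in> F" "\<And>y. y \<in> U \<Longrightarrow> g y = h y" "x \<in> U" for g h x
        unfolding poisson_bracket_def
        using diff_in_cong[OF Ham[OF that(2)] chart_at(1) x[OF that(4)] that(3)] by simp
    qed (simp_all add: poisson_bracket_def diff_in_scale diff_in_add diff_in_mult Ham chart_at)
  next
    show "?pb f g x = - ?pb g f x" if "f \<in> F" "g \<in> F" "x \<in> U" for f g x
      by (intro poisson_bracket_antisym Ham that)
    show "?pb f (?pb g h) x + ?pb g (?pb h f) x + ?pb h (?pb f g) x = 0"
      if "f \<in> F" "g \<in> F" "h \<in> F" "x \<in> U" for f g h x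
      using assms that unfolding poisson_algebra_def by blast
  qed
qed

end

text \<open>Of the geometric condition only the endpoints, the stay inside \<open>U\<close> and the
  exponential series are retained, as the locale requires.\<close>

lemma gauge_fixes_flow:
  assumes "gauge_fixes A om U F B C G" "x \<in> zero_set C \<inter> U"
  shows "\<exists>\<beta> h \<gamma>. termwise_sum F U UNIV (\<lambda>j z. \<beta> j * G j z) h \<and>
    (\<forall>t\<in>{0..1}. \<gamma> t \<in> U) \<and> \<gamma> 1 \<in> zero_set B \<and>
    (\<forall>f\<in>F. \<forall>t\<in>{0..1::real}. (\<lambda>n. t ^ n / fact n * (poisson_bracket A om h ^^ n) f x) sums f (\<gamma> t))"
proof -
  obtain \<beta> h y where "termwise_sum F U UNIV (\<lambda>j z. \<beta> j * G j z) h"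
    and flow: "flows_to A om U F h x y" and y: "\<forall>i. B i y = 0"
    using assms unfolding gauge_fixes_def by blast
  moreover obtain \<gamma> where "integral_curve A om U h \<gamma>" "\<gamma> 1 = y"
    "\<forall>f\<in>F. \<forall>t\<in>{0..1}. (\<lambda>n. t ^ n / fact n * (poisson_bracket A om h ^^ n) f x) sums f (\<gamma> t)"
    using flow unfolding flows_to_def by blast
  ultimately show ?thesis
    unfolding integral_curve_def zero_set_def by (intro exI[of _ \<beta>] exI[of _ h] exI[of _ \<gamma>]) auto
qed

theorem proposition2p3:
  fixes A :: "('p::t2_space, 'e::banach) chart set"
    and om :: "('p, 'e) chart \<Rightarrow> 'p \<Rightarrow> 'e \<Rightarrow> 'e \<Rightarrow> real"
    and U :: "'p set"
    and F :: "('p \<Rightarrow> real) set"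
    and D H :: "'j::linorder \<Rightarrow> 'p \<Rightarrow> real"
    and Minv :: "'j \<Rightarrow> 'j \<Rightarrow> 'p \<Rightarrow> real"
    and Deltainv :: "'j + 'j \<Rightarrow> 'j + 'j \<Rightarrow> 'p \<Rightarrow> real"
    and pb DB :: "('p \<Rightarrow> real) \<Rightarrow> ('p \<Rightarrow> real) \<Rightarrow> 'p \<Rightarrow> real"
    and D' H' :: "'j \<Rightarrow> 'p \<Rightarrow> real"
    and P Q :: "('p \<Rightarrow> real) \<Rightarrow> 'p \<Rightarrow> real"
    and SH SD :: "'p set"
    and OH OD :: "('p \<Rightarrow> real) set"
  assumes pb_def: "pb = poisson_bracket A om"
    and H'_def: "H' = H_prime Minv H"
    and D'_def: "D' = D_prime Minv D"
    and DB_def: "DB = dirac_bracket pb (combined D H) Deltainv"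
    and P_def: "P = projector pb D H'"
    and Q_def: "Q = projector pb (\<lambda>j x. - H j x) D'"
    and SH_def: "SH = zero_set H \<inter> U"
    and SD_def: "SD = zero_set D \<inter> U"
    and OH_def: "OH = weak_observables pb F U H"
    and OD_def: "OD = weak_observables pb F U D"
    and "banach_atlas A"
    and "symplectic_form A om"
    and "open U"
    and "poisson_algebra A om U F"
    and "first_class pb F U H" and "irreducible_constraints A U H"
    and "first_class pb F U D" and "irreducible_constraints A U D"
    and "zero_set D \<inter> zero_set H \<inter> U \<noteq> {}"
    \<comment> \<open>invertibility of \<open>M\<close> and of \<open>\<Delta>\<close>\<close>
    and "matrix_inverse F U (\<lambda>i j. pb (D i) (H j)) Minv"
    and "matrix_inverse F U (\<lambda>a b. pb (combined D H a) (combined D H b)) Deltainv"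
    \<comment> \<open>the sums defining \<open>H'\<close>, \<open>D'\<close>, the Dirac bracket and the two projectors make sense\<close>
    and "\<And>j. termwise_sum F U UNIV (\<lambda>i x. Minv i j x * H i x) (H' j)"
    and "\<And>j. termwise_sum F U UNIV (\<lambda>i x. Minv j i x * D i x) (D' j)"
    and "\<And>f g. f \<in> F \<Longrightarrow> g \<in> F \<Longrightarrow>
           termwise_sum F U UNIV (dirac_term pb (combined D H) Deltainv f g)
             (\<lambda>x. \<Sum>\<^sub>\<infinity>ab. dirac_term pb (combined D H) Deltainv f g ab x)"
    and "\<And>f. f \<in> F \<Longrightarrow> termwise_sum F U multi_indices (projector_term pb D H' f) (P f)"
    and "\<And>f. f \<in> F \<Longrightarrow> termwise_sum F U multi_indices (projector_term pb (\<lambda>j x. - H j x) D' f) (Q f)"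
    \<comment> \<open>the two families completely gauge fix one another\<close>
    and "gauge_fixes A om U F D H H'"
    and "gauge_fixes A om U F H D (\<lambda>i x. - D' i x)"
  shows
    "(\<forall>f\<in>F. P f \<in> OH) \<and> (\<forall>f\<in>F. Q f \<in> OD) \<and>
     \<comment> \<open>item 1\<close>
     (\<forall>f\<in>F. \<forall>g\<in>F.
        weakly_eq SH (pb (P f) (P g)) (P (DB f g)) \<and>
        weakly_eq SH (\<lambda>x. P f x * P g x) (P (\<lambda>x. f x * g x)) \<and>
        weakly_eq U (\<lambda>x. P f x + P g x) (P (\<lambda>x. f x + g x))) \<and>
     (\<forall>f\<in>OH. \<forall>g\<in>OH. weakly_eq SH (DB f g) (pb f g)) \<and>
     (\<forall>f\<in>OD. \<forall>g\<in>OD. weakly_eq SD (DB f g) (pb f g)) \<and>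
     \<comment> \<open>item 2\<close>
     (\<forall>f\<in>OH. weakly_eq SH (P f) f) \<and>
     \<comment> \<open>item 3\<close>
     (\<forall>f\<in>OD. \<forall>g\<in>OD.
        weakly_eq SH (pb (P f) (P g)) (P (pb f g)) \<and>
        weakly_eq SH (\<lambda>x. P f x * P g x) (P (\<lambda>x. f x * g x)) \<and>
        weakly_eq SH (\<lambda>x. P f x + P g x) (P (\<lambda>x. f x + g x))) \<and>
     (\<forall>f\<in>OH. weakly_eq SH (P (Q f)) f) \<and>
     (\<forall>f\<in>OD. weakly_eq SD (Q (P f)) f) \<and>
     \<comment> \<open>item 4\<close>
     (\<forall>f\<in>F. (\<forall>x\<in>zero_set D \<inter> zero_set H \<inter> U. f x = 0) \<longrightarrow> weakly_eq SH (P f) (\<lambda>x. 0))"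
proof -
  note algebra = \<open>poisson_algebra A om U F\<close>
    and first_class = \<open>first_class pb F U H\<close> \<open>first_class pb F U D\<close>
    and M_inverse = \<open>matrix_inverse F U (\<lambda>i j. pb (D i) (H j)) Minv\<close>
    and fixing = \<open>gauge_fixes A om U F D H H'\<close> \<open>gauge_fixes A om U F H D (\<lambda>i x. - D' i x)\<close>
  interpret poisson_functions F U pb
    unfolding pb_def
    by (rule symplectic_domain.poisson_functions[OF _ algebra], unfold_locales; fact)
  have D_mem: "D i \<in> F" and H_mem: "H i \<in> F" for i
    using first_class by (simp_all add: first_class_def)
  interpret PH: constraint_pair F U pb H D H' Minv Deltainv P
  proof
    show "termwise_sum F U UNIV (\<lambda>j x. pb (D i) (H j) x * Minv j k x) (\<lambda>x. if i = k then 1 else 0)"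
      "Minv i k \<in> F" for i k
      using M_inverse by (simp_all add: matrix_inverse_def)
    show "\<exists>\<beta> h \<gamma>. termwise_sum F U UNIV (\<lambda>j z. \<beta> j * H' j z) h \<and>
        (\<forall>t\<in>{0..1}. \<gamma> t \<in> U) \<and> \<gamma> 1 \<in> zero_set D \<and>
        (\<forall>f\<in>F. \<forall>t\<in>{0..1::real}. (\<lambda>n. t ^ n / fact n * (pb h ^^ n) f x) sums f (\<gamma> t))"
      if "x \<in> zero_set H \<inter> U" for x
      unfolding pb_def by (rule gauge_fixes_flow[OF fixing(1) that])
  qed (fact | rule assms D_mem; assumption)+
  have minus_H: "zero_set (\<lambda>j x. - H j x) = zero_set H"
    by (simp add: zero_set_def)
  interpret PD: constraint_pair F U pb D "\<lambda>j x. - H j x" D' "\<lambda>i j. Minv j i" PH.swapped_E Q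
  proof
    show "(\<lambda>x. - H i x) \<in> F" for i
      by (rule minus_mem[OF H_mem])
    show "Minv k i \<in> F" for i k
      by (rule PH.N_mem)
    have pb_minus: "pb (\<lambda>x. - H i x) (D j) x = pb (D j) (H i) x" if "x \<in> U" for i j x
      using der_minus[OF pb_der_left[OF D_mem] H_mem that] pb_antisym[OF H_mem D_mem that] by simp
    \<comment> \<open>Since {\<open>- H i\<close>, \<open>D j\<close>} = {\<open>D j\<close>,
      \<open>H i\<close>}, the matrix of the exchanged pair is the transpose of M, and its right
      inverse identity is the left one for M.\<close>
    have N_M: "termwise_sum F U UNIV (\<lambda>j x. Minv k j x * pb (D j) (H i) x)
        (\<lambda>x. if k = i then 1 else 0)" for i k
      using M_inverse by (simp add: matrix_inverse_def)
    show "termwise_sum F U UNIV (\<lambda>j x. pb (\<lambda>x. - H i x) (D j) x * Minv k j x)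
        (\<lambda>x. if i = k then 1 else 0)" for i k
      by (rule tsum_cong[OF N_M[of k i]]) (auto simp: pb_minus)
    show "\<exists>\<beta> h \<gamma>. termwise_sum F U UNIV (\<lambda>j z. \<beta> j * D' j z) h \<and>
        (\<forall>t\<in>{0..1}. \<gamma> t \<in> U) \<and> \<gamma> 1 \<in> zero_set (\<lambda>j x. - H j x) \<and>
        (\<forall>f\<in>F. \<forall>t\<in>{0..1::real}. (\<lambda>n. t ^ n / fact n * (pb h ^^ n) f x) sums f (\<gamma> t))"
      if x: "x \<in> zero_set D \<inter> U" for x
    proof -
      obtain \<beta> h \<gamma> where "termwise_sum F U UNIV (\<lambda>j z. \<beta> j * - D' j z) h"
        and *: "\<forall>t\<in>{0..1}. \<gamma> t \<in> U" "\<gamma> 1 \<in> zero_set H"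
          "\<forall>f\<in>F. \<forall>t\<in>{0..1::real}. (\<lambda>n. t ^ n / fact n * (pb h ^^ n) f x) sums f (\<gamma> t)"
        using gauge_fixes_flow[OF fixing(2) x] unfolding pb_def[symmetric] by blast
      \<comment> \<open>Gauge fixing was assumed for \<open>- D'\<close>; the sign moves into the
        constants and the Hamiltonian \<open>h\<close> stays the same.\<close>
      then have "termwise_sum F U UNIV (\<lambda>j z. (- \<beta> j) * D' j z) h"
        by simp
      with * show ?thesis
        unfolding minus_H by (intro exI[of _ "\<lambda>j. - \<beta> j"] exI[of _ h] exI[of _ \<gamma>]) auto
    qed
  qed (fact | rule PH.swapped_E_inverse | rule PH.swapped_dirac_sum assms; assumption)+
  have DB_D: "DB f g x = pb f g x" if "f \<in> OD" "g \<in> OD" "x \<in> SD" for f g x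
    using PD.DB_Obs[of f g x] PH.swapped_DB[of f g x] that
    by (simp add: DB_def SD_def OD_def PD.Obs_iff)
  have zero_OH: "(\<lambda>x. 0) \<in> OH"
    by (simp add: OH_def PH.Obs_iff der_const[OF pb_der[OF H_mem]])
  have OH_mem: "f \<in> F" if "f \<in> OH" for f
    using that by (simp add: OH_def PH.Obs_iff)
  have OD_mem: "f \<in> F" if "f \<in> OD" for f
    using that by (simp add: OD_def PD.Obs_iff)
  \<comment> \<open>On \<open>OD\<close> the two brackets agree on \<open>SD\<close>, which contains
    the common zeros, and on \<open>SH\<close> the image under \<open>P\<close> depends only on the
    values there.\<close>
  have bracket: "pb (P f) (P g) x = P (pb f g) x" if "f \<in> OD" "g \<in> OD" "x \<in> SH" for f g x
  proof -
    note mem = OD_mem[OF that(1)] OD_mem[OF that(2)]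
    have "P (DB f g) x = P (pb f g) x"
      unfolding DB_def
    proof (rule PH.P_determined[OF PH.DB_mem[OF mem] PH.P_Obs[OF pb_mem[OF mem]]])
      fix y assume y: "y \<in> PH.S \<inter> zero_set D"
      then have "DB f g y = pb f g y"
        by (intro DB_D that) (simp add: SD_def)
      then show "PH.DB f g y = P (pb f g) y"
        using y PH.P_gauge[OF pb_mem[OF mem]] by (simp add: DB_def)
    qed (use that in \<open>simp add: SH_def\<close>)
    then show ?thesis
      using PH.P_bracket[OF mem] that by (simp add: SH_def DB_def)
  qed
  show ?thesis
    unfolding weakly_eq_def
  proof (intro conjI ballI impI)
    show "P f \<in> OH" if "f \<in> F" for f
      unfolding OH_def by (rule PH.P_Obs[OF that])
    show "Q f \<in> OD" if "f \<in> F" for f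
      unfolding OD_def by (rule PD.P_Obs[OF that])
    show "pb (P f) (P g) x = P (DB f g) x" if "f \<in> F" "g \<in> F" "x \<in> SH" for f g x
      unfolding DB_def using PH.P_bracket that by (simp add: SH_def)
    show "P f x * P g x = P (\<lambda>x. f x * g x) x" if "f \<in> F" "g \<in> F" "x \<in> SH" for f g x
      using PH.P_mult that by (simp add: SH_def)
    show "P f x + P g x = P (\<lambda>x. f x + g x) x" if "f \<in> F" "g \<in> F" "x \<in> U" for f g x
      by (rule PH.P_add[OF that])
    show "DB f g x = pb f g x" if "f \<in> OH" "g \<in> OH" "x \<in> SH" for f g x
      using PH.DB_Obs that by (simp add: DB_def OH_def SH_def)
    show "DB f g x = pb f g x" if "f \<in> OD" "g \<in> OD" "x \<in> SD" for f g x
      by (rule DB_D[OF that])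
    show "P f x = f x" if "f \<in> OH" "x \<in> SH" for f x
      using PH.P_determined[OF OH_mem[OF that(1)]] that by (simp add: OH_def SH_def)
    show "pb (P f) (P g) x = P (pb f g) x" if "f \<in> OD" "g \<in> OD" "x \<in> SH" for f g x
      by (rule bracket[OF that])
    show "P f x * P g x = P (\<lambda>x. f x * g x) x" if "f \<in> OD" "g \<in> OD" "x \<in> SH" for f g x
      using PH.P_mult OD_mem that by (simp add: SH_def)
    show "P f x + P g x = P (\<lambda>x. f x + g x) x" if "f \<in> OD" "g \<in> OD" "x \<in> SH" for f g x
      using PH.P_add OD_mem that by (simp add: SH_def)
    show "P (Q f) x = f x" if f: "f \<in> OH" and x: "x \<in> SH" for f x
    proof (rule PH.P_determined[OF PD.P_mem[OF OH_mem[OF f]]])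
      \<comment> \<open>For the exchanged pair the gauge conditions are the \<open>- H j\<close>, so
        \<open>Q\<close> fixes values wherever \<open>H\<close> vanishes.\<close>
      show "Q f y = f y" if "y \<in> PH.S \<inter> zero_set D" for y
        using PD.P_gauge[OF OH_mem[OF f]] that by (simp add: minus_H)
    qed (use f x in \<open>simp_all add: OH_def SH_def\<close>)
    show "Q (P f) x = f x" if f: "f \<in> OD" and x: "x \<in> SD" for f x
    proof (rule PD.P_determined[OF PH.P_mem[OF OD_mem[OF f]]])
      show "P f y = f y" if "y \<in> PD.S \<inter> zero_set (\<lambda>j x. - H j x)" for y
        using PH.P_gauge[OF OD_mem[OF f]] that by simp
    qed (use f x in \<open>simp_all add: OD_def SD_def\<close>)
    show "P f x = 0"
      if f: "f \<in> F" and zero: "\<forall>x\<in>zero_set D \<inter> zero_set H \<inter> U. f x = 0" and x: "x \<in> SH" for f x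
      by (rule PH.P_determined[OF f, of "\<lambda>x. 0"]) (use zero x zero_OH in \<open>auto simp: SH_def OH_def\<close>)
  qed
qed

end
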